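(* Let $m, n \in \mathbb{N}$ with $m,n\ge 1$, let $(V_i)_{i=1}^m$ be a collection of pairwise disjoint, non-empty finite sets of vertices, and let $v_1,\dots,v_n$ be $n$ additional distinct single vertices, not belonging to any $V_i$. Let $a$ and $\lambda$ be positive constants. Define $Q_n(m)$ as the sum, over all rooted forests on the collection of $m+n$ vertex sets $V_1,\dots,V_m,\{v_1\},\dots,\{v_n\}$ (with $V_1$ as the distinguished first set), of the contribution of the forest, where the contribution of a forest is the product over its edges of the following factors: every edge between two additional vertices $v_k$ and $v_l$ contributes a factor $a$, whereas every other edge contributes a factor $\lambda$. Then $$Q_n(m) = \vert V_1\vert \,\lambda \left(\prod_{i=2}^m \rho_i(\lambda)\right) (\vert V\vert + n)^{m-1}\, (\lambda \vert V\vert + n a)^{n-1},$$ where $V := \bigcup_{i=1}^m V_i$ and $\rho_i(\lambda) := (1+\lambda)^{\vert V_i\vert }-1$ for $i=1,\dots,m$.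
   Context: Definition (rooted, or directed, forest on a collection of sets of vertices). Let $(W_i)_{i=1}^M$ be a collection of pairwise disjoint, non-empty finite sets. A rooted forest on $(W_i)_{i=1}^M$ is a (simple, undirected) graph on the vertex set $W_1\cup\dots\cup W_M$ such that: (1) its connected components are trees (isolated vertices being allowed); (2) there are no edges between two vertices of the same set $W_j$; (3) the reduced graph, obtained by collapsing each set $W_j$ to a single point and collapsing all edges between two given sets $W_i$ and $W_j$ to a single edge, is a single connected tree (on the $M$ points $1,\dots,M$); (4) for every $j\ge 2$, if $W_i$ is the set adjacent to $W_j$ on the path from $W_j$ to $W_1$ in the reduced tree, then all edges between $W_i$ and $W_j$ emanate from a single vertex of $W_i$ (called a root). Two rooted forests are distinct if they have different edge sets (vertices are labelled). In the claim this is applied with $M=m+n$, $W_i=V_i$ for $1\le i\le m$ and $W_{m+k}=\{v_k\}$ for $1\le k\le n$. Empty products equal $1$. *)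

theory Defs
  imports Complex_Main "HOL-Library.Disjoint_Sets"
begin

text \<open>
  A simple undirected graph is given by a vertex set \<open>U\<close> and a set \<open>E\<close> of two-element subsets
  of \<open>U\<close>. With the vertex set fixed, graphs are distinct iff their edge sets are.
\<close>

definition simple_graph :: "'a set \<Rightarrow> 'a set set \<Rightarrow> bool" where
  "simple_graph U E \<longleftrightarrow> finite U \<and> (\<forall>e\<in>E. e \<subseteq> U \<and> card e = 2)"

definition graph_walk :: "'a set \<Rightarrow> 'a set set \<Rightarrow> 'a list \<Rightarrow> bool" where
  "graph_walk U E p \<longleftrightarrow> p \<noteq> [] \<and> set p \<subseteq> U \<and> successively (\<lambda>x y. {x, y} \<in> E) p"

definition graph_path :: "'a set \<Rightarrow> 'a set set \<Rightarrow> 'a list \<Rightarrow> bool" where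
  "graph_path U E p \<longleftrightarrow> graph_walk U E p \<and> distinct p"

definition graph_cycle :: "'a set \<Rightarrow> 'a set set \<Rightarrow> 'a list \<Rightarrow> bool" where
  "graph_cycle U E p \<longleftrightarrow> graph_path U E p \<and> length p \<ge> 3 \<and> {last p, hd p} \<in> E"

definition joined :: "'a set \<Rightarrow> 'a set set \<Rightarrow> 'a \<Rightarrow> 'a \<Rightarrow> bool" where
  "joined U E x y \<longleftrightarrow> (\<exists>p. graph_walk U E p \<and> hd p = x \<and> last p = y)"

definition connected_graph :: "'a set \<Rightarrow> 'a set set \<Rightarrow> bool" where
  "connected_graph U E \<longleftrightarrow> U \<noteq> {} \<and> (\<forall>x\<in>U. \<forall>y\<in>U. joined U E x y)"

definition tree_graph :: "'a set \<Rightarrow> 'a set set \<Rightarrow> bool" where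
  "tree_graph U E \<longleftrightarrow> simple_graph U E \<and> connected_graph U E \<and> (\<nexists>p. graph_cycle U E p)"

definition graph_components :: "'a set \<Rightarrow> 'a set set \<Rightarrow> 'a set set" where
  "graph_components U E = (\<lambda>x. {y \<in> U. joined U E x y}) ` U"

text \<open>
  A collection \<open>W\<^sub>1, \<dots>, W\<^sub>M\<close> is a function \<open>W\<close> on \<open>{1..M}\<close>; its values elsewhere are irrelevant.
  The reduced graph has the indices \<open>1, \<dots>, M\<close> as vertices.
\<close>

definition reduced_edges :: "nat \<Rightarrow> (nat \<Rightarrow> 'a set) \<Rightarrow> 'a set set \<Rightarrow> nat set set" where
  "reduced_edges M W E =
     {{i, j} | i j. i \<in> {1..M} \<and> j \<in> {1..M} \<and> i \<noteq> j \<and> (\<exists>x\<in>W i. \<exists>y\<in>W j. {x, y} \<in> E)}"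

text \<open>
  In the last conjunct, \<open>p ! 1\<close> is the neighbour of \<open>j\<close> on the path \<open>p\<close> from \<open>j\<close> to \<open>1\<close>; since the
  reduced graph is a tree, this path exists and is unique.
\<close>

definition rooted_forest :: "nat \<Rightarrow> (nat \<Rightarrow> 'a set) \<Rightarrow> 'a set set \<Rightarrow> bool" where
  "rooted_forest M W E \<longleftrightarrow>
     simple_graph (\<Union>i\<in>{1..M}. W i) E \<and>
     (\<forall>C\<in>graph_components (\<Union>i\<in>{1..M}. W i) E. tree_graph C {e \<in> E. e \<subseteq> C}) \<and>
     (\<forall>j\<in>{1..M}. \<forall>x\<in>W j. \<forall>y\<in>W j. {x, y} \<notin> E) \<and>
     tree_graph {1..M} (reduced_edges M W E) \<and>
     (\<forall>j\<in>{2..M}. \<forall>p. graph_path {1..M} (reduced_edges M W E) p \<and> hd p = j \<and> last p = 1 \<longrightarrow>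
        (\<exists>r\<in>W (p ! 1). \<forall>x\<in>W (p ! 1). \<forall>y\<in>W j. {x, y} \<in> E \<longrightarrow> x = r))"

definition vertex_sets :: "nat \<Rightarrow> (nat \<Rightarrow> 'a set) \<Rightarrow> (nat \<Rightarrow> 'a) \<Rightarrow> nat \<Rightarrow> 'a set" where
  "vertex_sets m V v i = (if i \<le> m then V i else {v (i - m)})"

definition contribution :: "nat \<Rightarrow> (nat \<Rightarrow> 'a) \<Rightarrow> real \<Rightarrow> real \<Rightarrow> 'a set set \<Rightarrow> real" where
  "contribution n v a lam E = (\<Prod>e\<in>E. if e \<subseteq> v ` {1..n} then a else lam)"

definition Q :: "nat \<Rightarrow> nat \<Rightarrow> (nat \<Rightarrow> 'a set) \<Rightarrow> (nat \<Rightarrow> 'a) \<Rightarrow> real \<Rightarrow> real \<Rightarrow> real" where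
  "Q n m V v a lam =
     (\<Sum>E | rooted_forest (m + n) (vertex_sets m V v) E. contribution n v a lam E)"

definition rho :: "(nat \<Rightarrow> 'a set) \<Rightarrow> nat \<Rightarrow> real \<Rightarrow> real" where
  "rho V i lam = (1 + lam) ^ card (V i) - 1"

end

theory Submission
  imports Defs "HOL-Library.FuncSet"
begin

text \<open>
  A rooted forest is determined by the reduced tree, seen as a parent map \<open>f\<close> on \<open>{2..M}\<close> with
  root \<open>1\<close>, together with a root \<open>r \<in> W (f j)\<close> and a non-empty subset of \<open>W j\<close> for every \<open>j\<close>.
  Summing over the latter leaves a sum over parent maps of a product of weights \<open>w j (f j)\<close>, where
  \<open>w j p\<close> is \<open>\<rho>\<^sub>j c\<^sub>p\<close> for the sets \<open>V\<^sub>j\<close> and \<open>d\<^sub>p\<close> for the additional vertices. With roots \<open>R\<close>, remaining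
  points \<open>A\<close> and \<open>B\<close> of the two kinds, and \<open>C\<close>, \<open>D\<close> the total sums of \<open>c\<close> and \<open>d\<close>, this sum times
  \<open>C D\<close> is \<open>(\<Prod>\<rho>) C^|A| D^|B| (c\<^sub>R d\<^sub>R + c\<^sub>R d\<^sub>A + c\<^sub>B d\<^sub>R)\<close>. This follows by induction after summing over the
  set of children of the roots, since the totals \<open>C\<close> and \<open>D\<close> of the smaller instances do not depend
  on this set, so that the induction step is a binomial identity.
\<close>

subsection \<open>Weighted sums over parent maps\<close>

text \<open>
  The existence of a strictly decreasing rank \<open>d\<close> says that iterating \<open>f\<close> leads from \<open>S\<close> into the
  root set \<open>R\<close>.
\<close>

definition parent_maps :: "'b set \<Rightarrow> 'b set \<Rightarrow> ('b \<Rightarrow> 'b) set" where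
  "parent_maps R S = {f \<in> S \<rightarrow>\<^sub>E R \<union> S. \<exists>d :: 'b \<Rightarrow> nat. \<forall>j\<in>S. d (f j) < d j}"

lemma parent_mapsI:
  assumes "f \<in> S \<rightarrow>\<^sub>E R \<union> S" "\<And>j. j \<in> S \<Longrightarrow> (d :: 'b \<Rightarrow> nat) (f j) < d j"
  shows "f \<in> parent_maps R S"
  using assms unfolding parent_maps_def by blast

lemma finite_parent_maps:
  assumes "finite R" "finite S"
  shows "finite (parent_maps R S)"
proof (rule finite_subset)
  show "parent_maps R S \<subseteq> S \<rightarrow>\<^sub>E R \<union> S"
    unfolding parent_maps_def by blast
  show "finite (S \<rightarrow>\<^sub>E R \<union> S)" by (rule finite_PiE) (simp_all add: assms)
qed

lemma parent_maps_empty_domain: "parent_maps R {} = {\<lambda>_. undefined}"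
  by (auto simp: parent_maps_def)

text \<open>A point of \<open>S\<close> of least rank would have its parent in \<open>S\<close> with
  a smaller rank. In the later induction this makes the term for an empty set of children of the
  roots vanish.\<close>

lemma parent_maps_empty_roots:
  fixes S :: "'b set"
  assumes "S \<noteq> {}"
  shows "parent_maps {} S = {}"
proof (rule equals0I)
  fix f assume "f \<in> parent_maps {} S"
  then obtain d :: "'b \<Rightarrow> nat" where f: "f \<in> S \<rightarrow>\<^sub>E {} \<union> S" and d: "\<And>j. j \<in> S \<Longrightarrow> d (f j) < d j"
    unfolding parent_maps_def by blast
  obtain j where j: "j \<in> S" "\<forall>k. k \<in> S \<longrightarrow> d j \<le> d k"
    using ex_has_least_nat[of "\<lambda>j. j \<in> S" _ d] assms by blast
  moreover have "f j \<in> S" using f j(1) by auto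
  ultimately show False using d[of j] by force
qed

text \<open>A point outside \<open>T\<close> has its parent in \<open>S\<close>, so once the points
  of \<open>T\<close> are promoted to roots, the rest of \<open>f\<close> is again a parent map. On
  \<open>T\<close> the values in \<open>R\<close> are unconstrained, because no cycle can pass
  through a root.\<close>

lemma bij_betw_parent_maps_layer:
  fixes R S T :: "'b set"
  assumes RS: "R \<inter> S = {}" and T: "T \<subseteq> S"
  shows "bij_betw (\<lambda>f. (restrict f T, restrict f (S - T)))
    {f \<in> parent_maps R S. {j \<in> S. f j \<in> R} = T} ((T \<rightarrow>\<^sub>E R) \<times> parent_maps T (S - T))"
proof (rule bij_betw_byWitness[where f' = "\<lambda>(g, h). (\<lambda>j. if j \<in> T then g j else h j)"])
  let ?X = "{f \<in> parent_maps R S. {j \<in> S. f j \<in> R} = T}"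
  have PiE: "f \<in> S \<rightarrow>\<^sub>E R \<union> S" if "f \<in> ?X" for f
    using that by (simp add: parent_maps_def)
  show "\<forall>f\<in>?X. (case (restrict f T, restrict f (S - T)) of (g, h) \<Rightarrow> \<lambda>j. if j \<in> T then g j else h j) = f"
  proof
    fix f assume "f \<in> ?X"
    then have "f j = undefined" if "j \<notin> S" for j by (rule PiE_arb[OF PiE that])
    then show "(case (restrict f T, restrict f (S - T)) of (g, h) \<Rightarrow> \<lambda>j. if j \<in> T then g j else h j) = f"
      using T by (auto simp: fun_eq_iff)
  qed
  show "\<forall>p\<in>(T \<rightarrow>\<^sub>E R) \<times> parent_maps T (S - T).
      (restrict (case p of (g, h) \<Rightarrow> \<lambda>j. if j \<in> T then g j else h j) T,
       restrict (case p of (g, h) \<Rightarrow> \<lambda>j. if j \<in> T then g j else h j) (S - T)) = p"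
  proof
    fix p assume "p \<in> (T \<rightarrow>\<^sub>E R) \<times> parent_maps T (S - T)"
    then obtain g h where p: "p = (g, h)" and gh: "g \<in> T \<rightarrow>\<^sub>E R" "h \<in> S - T \<rightarrow>\<^sub>E T \<union> (S - T)"
      unfolding parent_maps_def by blast
    have "g j = undefined" if "j \<notin> T" for j by (rule PiE_arb[OF gh(1) that])
    moreover have "h j = undefined" if "j \<notin> S - T" for j by (rule PiE_arb[OF gh(2) that])
    ultimately show "(restrict (case p of (g, h) \<Rightarrow> \<lambda>j. if j \<in> T then g j else h j) T,
       restrict (case p of (g, h) \<Rightarrow> \<lambda>j. if j \<in> T then g j else h j) (S - T)) = p"
      unfolding p by (auto simp: fun_eq_iff)
  qed
  show "(\<lambda>f. (restrict f T, restrict f (S - T))) ` ?X \<subseteq> (T \<rightarrow>\<^sub>E R) \<times> parent_maps T (S - T)"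
  proof (rule image_subsetI)
    fix f assume f: "f \<in> ?X"
    then have T_eq: "{j \<in> S. f j \<in> R} = T" by simp
    have fT: "f j \<in> R \<longleftrightarrow> j \<in> T" if "j \<in> S" for j
      unfolding T_eq[symmetric] using that by simp
    have "f \<in> parent_maps R S" using f by simp
    then obtain d :: "'b \<Rightarrow> nat" where fS: "f \<in> S \<rightarrow>\<^sub>E R \<union> S" and d: "\<And>j. j \<in> S \<Longrightarrow> d (f j) < d j"
      unfolding parent_maps_def by blast
    have "restrict f T \<in> T \<rightarrow>\<^sub>E R" using fT T by auto
    moreover have "restrict f (S - T) \<in> S - T \<rightarrow>\<^sub>E T \<union> (S - T)"
    proof (intro restrict_PiE_iff[THEN iffD2] ballI)
      fix j assume j: "j \<in> S - T"
      then have "f j \<in> R \<union> S" using fS by auto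
      moreover have "f j \<notin> R" using fT j by blast
      ultimately show "f j \<in> T \<union> (S - T)" by blast
    qed
    then have "restrict f (S - T) \<in> parent_maps T (S - T)"
      by (rule parent_mapsI[where d = d]) (use d in auto)
    ultimately show "(restrict f T, restrict f (S - T)) \<in> (T \<rightarrow>\<^sub>E R) \<times> parent_maps T (S - T)" by blast
  qed
  show "(\<lambda>(g, h). (\<lambda>j. if j \<in> T then g j else h j)) ` ((T \<rightarrow>\<^sub>E R) \<times> parent_maps T (S - T)) \<subseteq> ?X"
  proof (rule image_subsetI)
    fix gh assume "gh \<in> (T \<rightarrow>\<^sub>E R) \<times> parent_maps T (S - T)"
    then obtain g h where gh: "gh = (g, h)" and g: "g \<in> T \<rightarrow>\<^sub>E R" and "h \<in> parent_maps T (S - T)"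
      by blast
    then obtain d :: "'b \<Rightarrow> nat" where h: "h \<in> S - T \<rightarrow>\<^sub>E T \<union> (S - T)"
      and d: "\<And>j. j \<in> S - T \<Longrightarrow> d (h j) < d j"
      unfolding parent_maps_def by blast
    let ?f = "\<lambda>j. if j \<in> T then g j else h j"
    have gR: "g j \<in> R" if "j \<in> T" for j using g that by auto
    have hS: "h j \<in> S" if "j \<in> S - T" for j using h that T by auto
    \<comment> \<open>Roots get rank 0 and all other ranks are shifted up by one, so that a point of
      \<open>T\<close> lies above its parent in \<open>R\<close> whatever \<open>d\<close> says
      there.\<close>
    have "?f \<in> parent_maps R S"
    proof (rule parent_mapsI[where d = "\<lambda>j. if j \<in> R then 0 else Suc (d j)"])
      show "?f \<in> S \<rightarrow>\<^sub>E R \<union> S"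
      proof (rule PiE_I)
        show "?f j \<in> R \<union> S" if "j \<in> S" for j using gR[of j] hS[of j] that by auto
        show "?f j = undefined" if "j \<notin> S" for j using PiE_arb[OF h, of j] that T by auto
      qed
      fix j assume "j \<in> S"
      then show "(if ?f j \<in> R then 0 else Suc (d (?f j))) < (if j \<in> R then 0 else Suc (d j))"
        using RS gR[of j] d[of j] by auto
    qed
    moreover have "{j \<in> S. ?f j \<in> R} = T"
      using RS T gR hS by auto
    ultimately show "(case gh of (g, h) \<Rightarrow> \<lambda>j. if j \<in> T then g j else h j) \<in> ?X"
      by (simp add: gh)
  qed
qed

text \<open>Parent maps are split according to the set \<open>T\<close> of points whose parent is a root.\<close>

lemma sum_parent_maps_layer:
  fixes w :: "'b \<Rightarrow> 'b \<Rightarrow> real"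
  assumes "finite R" "finite S" "R \<inter> S = {}"
  shows "(\<Sum>f\<in>parent_maps R S. \<Prod>j\<in>S. w j (f j)) =
    (\<Sum>T\<in>Pow S. (\<Prod>j\<in>T. \<Sum>p\<in>R. w j p) * (\<Sum>f\<in>parent_maps T (S - T). \<Prod>j\<in>S - T. w j (f j)))"
proof -
  have "(\<Sum>f\<in>parent_maps R S. \<Prod>j\<in>S. w j (f j)) =
    (\<Sum>T\<in>Pow S. \<Sum>f | f \<in> parent_maps R S \<and> {j \<in> S. f j \<in> R} = T. \<Prod>j\<in>S. w j (f j))"
    by (rule sum.group[symmetric]) (use assms in \<open>auto intro: finite_parent_maps\<close>)
  also have "\<dots> = (\<Sum>T\<in>Pow S. (\<Prod>j\<in>T. \<Sum>p\<in>R. w j p) * (\<Sum>f\<in>parent_maps T (S - T). \<Prod>j\<in>S - T. w j (f j)))"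
  proof (rule sum.cong[OF refl])
    fix T assume "T \<in> Pow S"
    then have T: "T \<subseteq> S" "finite T" using assms by (auto intro: finite_subset)
    have "(\<Sum>f | f \<in> parent_maps R S \<and> {j \<in> S. f j \<in> R} = T. \<Prod>j\<in>S. w j (f j)) =
      (\<Sum>f | f \<in> parent_maps R S \<and> {j \<in> S. f j \<in> R} = T.
        (\<lambda>(g, h). (\<Prod>j\<in>T. w j (g j)) * (\<Prod>j\<in>S - T. w j (h j))) (restrict f T, restrict f (S - T)))"
      by (rule sum.cong[OF refl]) (use T assms in \<open>simp add: prod.subset_diff[of T S] mult.commute\<close>)
    also have "\<dots> = (\<Sum>(g, h)\<in>(T \<rightarrow>\<^sub>E R) \<times> parent_maps T (S - T).
        (\<Prod>j\<in>T. w j (g j)) * (\<Prod>j\<in>S - T. w j (h j)))"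
      using T assms by (intro sum.reindex_bij_betw bij_betw_parent_maps_layer)
    also have "\<dots> = (\<Sum>g\<in>T \<rightarrow>\<^sub>E R. \<Prod>j\<in>T. w j (g j)) * (\<Sum>f\<in>parent_maps T (S - T). \<Prod>j\<in>S - T. w j (f j))"
      by (simp add: sum_product sum.cartesian_product)
    also have "(\<Sum>g\<in>T \<rightarrow>\<^sub>E R. \<Prod>j\<in>T. w j (g j)) = (\<Prod>j\<in>T. \<Sum>p\<in>R. w j p)"
      using T assms by (simp add: prod_sum_PiE)
    finally show "(\<Sum>f | f \<in> parent_maps R S \<and> {j \<in> S. f j \<in> R} = T. \<Prod>j\<in>S. w j (f j)) =
      (\<Prod>j\<in>T. \<Sum>p\<in>R. w j p) * (\<Sum>f\<in>parent_maps T (S - T). \<Prod>j\<in>S - T. w j (f j))" .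
  qed
  finally show ?thesis .
qed

section \<open>Binomial sums over subsets\<close>

lemma sum_Pow_insert:
  fixes g :: "'b set \<Rightarrow> real"
  assumes "finite A" "a \<notin> A"
  shows "(\<Sum>T\<in>Pow (insert a A). g T) = (\<Sum>T\<in>Pow A. g T) + (\<Sum>T\<in>Pow A. g (insert a T))"
proof -
  have "inj_on (insert a) (Pow A)" using assms(2) by (auto simp: inj_on_def)
  then show ?thesis
    unfolding Pow_insert using assms
    by (subst sum.union_disjoint) (auto simp: sum.reindex)
qed

text \<open>The binomial theorem before subsets of equal size are collected.\<close>

lemma sum_Pow_powers:
  fixes x y :: real
  assumes "finite A"
  shows "(\<Sum>T\<in>Pow A. x ^ card T * y ^ card (A - T)) = (x + y) ^ card A"
  using assms
proof (induction A)
  case (insert a A)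
  have "(\<Sum>T\<in>Pow A. x ^ card T * y ^ card (insert a A - T)) = (\<Sum>T\<in>Pow A. y * (x ^ card T * y ^ card (A - T)))"
    using insert by (intro sum.cong) (auto simp: insert_Diff_if finite_subset)
  moreover have "(\<Sum>T\<in>Pow A. x ^ card (insert a T) * y ^ card (insert a A - insert a T))
      = (\<Sum>T\<in>Pow A. x * (x ^ card T * y ^ card (A - T)))"
  proof (rule sum.cong[OF refl])
    fix T assume "T \<in> Pow A"
    then have "finite T" "a \<notin> T" "insert a A - insert a T = A - T"
      using insert by (auto intro: finite_subset)
    then show "x ^ card (insert a T) * y ^ card (insert a A - insert a T) = x * (x ^ card T * y ^ card (A - T))"
      by simp
  qed
  ultimately show ?case
    using insert by (simp add: sum_Pow_insert algebra_simps flip: sum_distrib_left)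
qed simp

text \<open>After exchanging sums, each point \<open>a\<close> of \<open>A\<close> contributes
  \<open>c a\<close> times the sum over the sets containing it, which is
  \<open>x * (x + y) ^ (card A - 1)\<close>. The factor \<open>x + y\<close> on the left avoids the
  lowered exponent.\<close>

lemma sum_Pow_weighted_powers:
  fixes x y :: real and c :: "'b \<Rightarrow> real"
  assumes "finite A"
  shows "(x + y) * (\<Sum>T\<in>Pow A. sum c T * (x ^ card T * y ^ card (A - T))) = sum c A * x * (x + y) ^ card A"
  using assms
proof (induction A)
  case (insert a A)
  let ?s = "\<Sum>T\<in>Pow A. sum c T * (x ^ card T * y ^ card (A - T))"
  have 1: "(\<Sum>T\<in>Pow A. sum c T * (x ^ card T * y ^ card (insert a A - T))) = y * ?s"
    unfolding sum_distrib_left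
    using insert by (intro sum.cong) (auto simp: insert_Diff_if finite_subset)
  have "(\<Sum>T\<in>Pow A. sum c (insert a T) * (x ^ card (insert a T) * y ^ card (insert a A - insert a T)))
      = (\<Sum>T\<in>Pow A. c a * x * (x ^ card T * y ^ card (A - T)) + x * (sum c T * (x ^ card T * y ^ card (A - T))))"
  proof (rule sum.cong[OF refl])
    fix T assume "T \<in> Pow A"
    then have "finite T" "a \<notin> T" "insert a A - insert a T = A - T"
      using insert by (auto intro: finite_subset)
    then show "sum c (insert a T) * (x ^ card (insert a T) * y ^ card (insert a A - insert a T))
      = c a * x * (x ^ card T * y ^ card (A - T)) + x * (sum c T * (x ^ card T * y ^ card (A - T)))"
      by (simp add: algebra_simps)
  qed
  also have "\<dots> = c a * x * (x + y) ^ card A + x * ?s"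
    using insert by (simp add: sum.distrib sum_Pow_powers flip: sum_distrib_left)
  finally have "(x + y) * (\<Sum>T\<in>Pow (insert a A). sum c T * (x ^ card T * y ^ card (insert a A - T)))
     = (x + y) * ((x + y) * ?s) + c a * x * (x + y) ^ card (insert a A)"
    using insert 1 by (simp add: sum_Pow_insert algebra_simps)
  also have "(x + y) * ?s = sum c A * x * (x + y) ^ card A" by (rule insert.IH)
  finally show ?case using insert.hyps by (simp add: algebra_simps)
qed simp

lemma sum_Pow_split:
  fixes g :: "'b set \<Rightarrow> real"
  shows "(\<Sum>T\<in>Pow S. g T) = (\<Sum>T\<in>Pow (S \<inter> A). \<Sum>U\<in>Pow (S - A). g (T \<union> U))"
proof -
  have "bij_betw (\<lambda>(T, U). T \<union> U) (Pow (S \<inter> A) \<times> Pow (S - A)) (Pow S)"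
    by (rule bij_betw_byWitness[where f' = "\<lambda>T. (T \<inter> A, T - A)"]) auto
  from sum.reindex_bij_betw[OF this, of g] show ?thesis
    by (simp add: sum.cartesian_product case_prod_unfold)
qed

text \<open>The induction step for parent maps: \<open>x\<close> and \<open>u\<close> stand for the
  totals of \<open>c\<close> and \<open>d\<close> over the roots, \<open>y\<close> and
  \<open>z\<close> are those over the remaining points, and \<open>T\<close> is the set of children
  of the roots. Splitting \<open>T\<close> by type reduces everything to sums over one type.\<close>

lemma two_type_binomial_identity:
  fixes c d :: "'b \<Rightarrow> real" and x u :: real
  assumes "finite S"
  defines "y \<equiv> sum c S" and "z \<equiv> sum d S"
  shows "(x + y) * (u + z) *
    (\<Sum>T\<in>Pow S. x ^ card (T \<inter> A) * u ^ card (T - A) * y ^ card ((S - T) \<inter> A) * z ^ card (S - T - A) *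
       (sum c T * sum d T + sum c T * sum d ((S - T) \<inter> A) + sum c (S - T - A) * sum d T))
    = (x + y) ^ card (S \<inter> A) * (u + z) ^ card (S - A) *
       (y * z * (x * u + x * sum d (S \<inter> A) + sum c (S - A) * u))"
proof -
  let ?A = "S \<inter> A" and ?B = "S - A"
  have fin: "finite ?A" "finite ?B" using assms by auto
  \<comment> \<open>\<open>p\<close> and \<open>q\<close> are the binomial weights of the two types;
    the suffixes \<open>c\<close> and \<open>d\<close> below mark sums weighted by
    \<open>sum c\<close> and \<open>sum d\<close>.\<close>
  define p where "p T = x ^ card T * y ^ card (?A - T)" for T
  define q where "q U = u ^ card U * z ^ card (?B - U)" for U
  define P where "P = sum p (Pow ?A)"
  define Pc where "Pc = (\<Sum>T\<in>Pow ?A. sum c T * p T)"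
  define Pd where "Pd = (\<Sum>T\<in>Pow ?A. sum d T * p T)"
  define Q0 where "Q0 = sum q (Pow ?B)"
  define Qc where "Qc = (\<Sum>U\<in>Pow ?B. sum c U * q U)"
  define Qd where "Qd = (\<Sum>U\<in>Pow ?B. sum d U * q U)"
  note defs = P_def Pc_def Pd_def Q0_def Qc_def Qd_def
  have P: "P = (x + y) ^ card ?A" "(x + y) * Pc = sum c ?A * x * P" "(x + y) * Pd = sum d ?A * x * P"
    and Q: "Q0 = (u + z) ^ card ?B" "(u + z) * Qc = sum c ?B * u * Q0" "(u + z) * Qd = sum d ?B * u * Q0"
    unfolding defs p_def q_def sum_Pow_powers[OF fin(1)] sum_Pow_powers[OF fin(2)]
      sum_Pow_weighted_powers[OF fin(1)] sum_Pow_weighted_powers[OF fin(2)] by simp_all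
  have y: "y = sum c ?A + sum c ?B" and z: "z = sum d ?A + sum d ?B"
    unfolding y_def z_def using assms(1) by (simp_all add: sum.Int_Diff)
  \<comment> \<open>With \<open>T\<close> and \<open>U\<close> the two parts of the subset, the
    products \<open>sum c T * sum d T\<close> and \<open>sum c U * sum d U\<close> cancel. Every
    remaining term is at most linear in each part, so the weighted binomial sums suffice.\<close>
  have "(\<Sum>T\<in>Pow S. x ^ card (T \<inter> A) * u ^ card (T - A) * y ^ card ((S - T) \<inter> A) * z ^ card (S - T - A) *
       (sum c T * sum d T + sum c T * sum d ((S - T) \<inter> A) + sum c (S - T - A) * sum d T))
    = (\<Sum>T\<in>Pow ?A. \<Sum>U\<in>Pow ?B. p T * q U * (sum c T * sum d U + sum c T * sum d ?A + sum c U * sum d ?A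
         + sum c ?B * sum d T + sum c ?B * sum d U - sum c U * sum d T))"
    unfolding sum_Pow_split[of _ S A]
  proof (intro sum.cong refl)
    fix T U assume "T \<in> Pow ?A" "U \<in> Pow ?B"
    then have TU: "T \<subseteq> ?A" "U \<subseteq> ?B" by auto
    then have f: "finite T" "finite U" using fin by (blast intro: finite_subset)+
    have eqs: "(T \<union> U) \<inter> A = T" "(T \<union> U) - A = U" "(S - (T \<union> U)) \<inter> A = ?A - T" "S - (T \<union> U) - A = ?B - U"
      "T \<inter> U = {}" using TU by auto
    have 1: "sum c (T \<union> U) = sum c T + sum c U" "sum d (T \<union> U) = sum d T + sum d U"
      using f eqs(5) by (simp_all add: sum.union_disjoint)
    have 2: "sum d (?A - T) = sum d ?A - sum d T" "sum c (?B - U) = sum c ?B - sum c U"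
      using TU f fin by (simp_all add: sum_diff)
    show "x ^ card ((T \<union> U) \<inter> A) * u ^ card (T \<union> U - A) * y ^ card ((S - (T \<union> U)) \<inter> A) *
        z ^ card (S - (T \<union> U) - A) *
        (sum c (T \<union> U) * sum d (T \<union> U) + sum c (T \<union> U) * sum d ((S - (T \<union> U)) \<inter> A) +
          sum c (S - (T \<union> U) - A) * sum d (T \<union> U))
      = p T * q U * (sum c T * sum d U + sum c T * sum d ?A + sum c U * sum d ?A
         + sum c ?B * sum d T + sum c ?B * sum d U - sum c U * sum d T)"
      unfolding eqs p_def q_def 1 2 by (simp add: algebra_simps)
  qed
  also have "\<dots> = Pc * Qd + Pc * Q0 * sum d ?A + P * Qc * sum d ?A + Pd * Q0 * sum c ?B
      + P * Qd * sum c ?B - Pd * Qc"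
  proof -
    have "p T * q U * (sum c T * sum d U + sum c T * sum d ?A + sum c U * sum d ?A
         + sum c ?B * sum d T + sum c ?B * sum d U - sum c U * sum d T) =
      (sum c T * p T) * (sum d U * q U) + (sum c T * p T) * (q U * sum d ?A)
       + p T * (sum c U * q U * sum d ?A) + (sum d T * p T) * (q U * sum c ?B)
       + p T * (sum d U * q U * sum c ?B) - (sum d T * p T) * (sum c U * q U)" for T U
      by (simp add: algebra_simps)
    then show ?thesis
      by (simp only: sum.distrib sum_subtractf sum_product[symmetric] sum_distrib_right[symmetric]
          flip: defs)
  qed
  finally have *: "(\<Sum>T\<in>Pow S. x ^ card (T \<inter> A) * u ^ card (T - A) * y ^ card ((S - T) \<inter> A) * z ^ card (S - T - A) *
       (sum c T * sum d T + sum c T * sum d ((S - T) \<inter> A) + sum c (S - T - A) * sum d T)) = \<dots>" .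
  have "(x + y) * (u + z) * (Pc * Qd + Pc * Q0 * sum d ?A + P * Qc * sum d ?A + Pd * Q0 * sum c ?B
      + P * Qd * sum c ?B - Pd * Qc)
    = ((x + y) * Pc) * ((u + z) * Qd) + ((x + y) * Pc) * ((u + z) * Q0) * sum d ?A
      + ((x + y) * P) * ((u + z) * Qc) * sum d ?A + ((x + y) * Pd) * ((u + z) * Q0) * sum c ?B
      + ((x + y) * P) * ((u + z) * Qd) * sum c ?B - ((x + y) * Pd) * ((u + z) * Qc)"
    by (simp add: algebra_simps)
  \<comment> \<open>Up to the factor \<open>P * Q0\<close>, the coefficient of \<open>x * u\<close>
    is the product of the two full sums, that is \<open>y * z\<close>; the other terms group as
    \<open>x * z * y * sum d ?A\<close> and \<open>y * u * z * sum c ?B\<close>.\<close>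
  also have "\<dots> = P * Q0 * (y * z * (x * u + x * sum d ?A + sum c ?B * u))"
    unfolding P(2,3) Q(2,3) unfolding y z by (simp add: algebra_simps)
  finally show ?thesis unfolding * P(1) Q(1) .
qed

text \<open>The two totals multiplied on the left stand in for exponents lowered by one. The smaller
  instances have other roots, so the induction runs over all \<open>R\<close> at once; positivity
  allows the totals over \<open>S\<close> to be cancelled.\<close>

lemma sum_parent_maps_two_types:
  fixes c d \<rho> :: "'b \<Rightarrow> real"
  assumes "finite R" "finite S" "R \<inter> S = {}"
    and "\<And>p. p \<in> R \<union> S \<Longrightarrow> c p > 0" "\<And>p. p \<in> R \<union> S \<Longrightarrow> d p > 0"
  shows "(\<Sum>f\<in>parent_maps R S. \<Prod>j\<in>S. if j \<in> A then \<rho> j * c (f j) else d (f j)) *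
      (sum c (R \<union> S) * sum d (R \<union> S)) =
    prod \<rho> (S \<inter> A) * sum c (R \<union> S) ^ card (S \<inter> A) * sum d (R \<union> S) ^ card (S - A) *
      (sum c R * sum d R + sum c R * sum d (S \<inter> A) + sum c (S - A) * sum d R)"
  using assms
proof (induction "card S" arbitrary: R S rule: less_induct)
  case less
  note finR = less.prems(1) and finS = less.prems(2) and RS = less.prems(3) and pos = less.prems(4,5)
  define F where "F R S = (\<Sum>f\<in>parent_maps R S. \<Prod>j\<in>S. if j \<in> A then \<rho> j * c (f j) else d (f j))" for R S
  define K where "K R S = sum c R * sum d R + sum c R * sum d (S \<inter> A) + sum c (S - A) * sum d R" for R S
  show ?case
  proof (cases "S = {}")
    case True
    then show ?thesis by (simp add: parent_maps_empty_domain)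
  next
    case False
    define x where "x = sum c R"
    define u where "u = sum d R"
    define y where "y = sum c S"
    define z where "z = sum d S"
    have yz: "y > 0" "z > 0" unfolding y_def z_def using finS False pos by (auto intro: sum_pos)
    have xu: "sum c (R \<union> S) = x + y" "sum d (R \<union> S) = u + z"
      unfolding x_def u_def y_def z_def using finR finS RS by (simp_all add: sum.union_disjoint)
    have layer: "(\<Prod>j\<in>T. \<Sum>p\<in>R. if j \<in> A then \<rho> j * c p else d p) = prod \<rho> (T \<inter> A) * x ^ card (T \<inter> A) * u ^ card (T - A)"
      if "T \<subseteq> S" for T
    proof -
      have fin: "finite T" using that finS by (rule finite_subset)
      have "(\<Prod>j\<in>T. \<Sum>p\<in>R. if j \<in> A then \<rho> j * c p else d p) = (\<Prod>j\<in>T. if j \<in> A then \<rho> j * x else u)"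
        unfolding x_def u_def by (intro prod.cong) (auto simp: sum_distrib_left)
      also have "\<dots> = (\<Prod>j\<in>T \<inter> A. \<rho> j * x) * (\<Prod>j\<in>T - A. u)"
        using fin by (simp add: prod.If_cases Diff_eq)
      finally show ?thesis by (simp add: prod.distrib)
    qed
    \<comment> \<open>The children \<open>T\<close> are the roots of the smaller instance, and
      \<open>T\<close> together with \<open>S - T\<close> is \<open>S\<close>, so its totals are
      \<open>y\<close> and \<open>z\<close> for every \<open>T\<close>. For empty \<open>T\<close>
      both sides are zero.\<close>
    have IH: "F T (S - T) * (y * z) =
        prod \<rho> ((S - T) \<inter> A) * y ^ card ((S - T) \<inter> A) * z ^ card (S - T - A) * K T (S - T)"
      if T: "T \<subseteq> S" for T
    proof (cases "T = {}")
      case True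
      then show ?thesis using False by (simp add: F_def K_def parent_maps_empty_roots)
    next
      case nonempty: False
      have "S - T \<subset> S" using T nonempty by blast
      moreover have "T \<union> (S - T) = S" using T by blast
      ultimately show ?thesis
        using less.hyps[of "S - T" T] finS T pos unfolding F_def K_def y_def z_def
        by (auto simp: psubset_card_mono finite_subset)
    qed
    have "F R S = (\<Sum>T\<in>Pow S. (\<Prod>j\<in>T. \<Sum>p\<in>R. if j \<in> A then \<rho> j * c p else d p) * F T (S - T))"
      unfolding F_def by (rule sum_parent_maps_layer) (use finR finS RS in auto)
    \<comment> \<open>The common factor \<open>y * z\<close> supplies each summand with what the
      induction hypothesis needs, without any division.\<close>
    then have "F R S * (y * z) =
        (\<Sum>T\<in>Pow S. (\<Prod>j\<in>T. \<Sum>p\<in>R. if j \<in> A then \<rho> j * c p else d p) * (F T (S - T) * (y * z)))"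
      by (simp add: sum_distrib_right mult.assoc)
    also have "\<dots> = prod \<rho> (S \<inter> A) * (\<Sum>T\<in>Pow S. x ^ card (T \<inter> A) * u ^ card (T - A) *
        y ^ card ((S - T) \<inter> A) * z ^ card (S - T - A) * K T (S - T))"
      unfolding sum_distrib_left
    proof (rule sum.cong[OF refl])
      fix T assume "T \<in> Pow S"
      then have T: "T \<subseteq> S" by simp
      have "S \<inter> A = (T \<inter> A) \<union> ((S - T) \<inter> A)" using T by blast
      then have "prod \<rho> (S \<inter> A) = prod \<rho> (T \<inter> A) * prod \<rho> ((S - T) \<inter> A)"
        using finS T by (auto intro!: prod.union_disjoint intro: finite_subset)
      then show "(\<Prod>j\<in>T. \<Sum>p\<in>R. if j \<in> A then \<rho> j * c p else d p) * (F T (S - T) * (y * z)) =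
          prod \<rho> (S \<inter> A) * (x ^ card (T \<inter> A) * u ^ card (T - A) *
            y ^ card ((S - T) \<inter> A) * z ^ card (S - T - A) * K T (S - T))"
        unfolding layer[OF T] IH[OF T] by (simp add: ac_simps)
    qed
    finally have "(F R S * ((x + y) * (u + z))) * (y * z) = prod \<rho> (S \<inter> A) * ((x + y) * (u + z) *
        (\<Sum>T\<in>Pow S. x ^ card (T \<inter> A) * u ^ card (T - A) *
        y ^ card ((S - T) \<inter> A) * z ^ card (S - T - A) * K T (S - T)))"
      by (simp add: ac_simps)
    also have "\<dots> = prod \<rho> (S \<inter> A) * ((x + y) ^ card (S \<inter> A) * (u + z) ^ card (S - A) * (y * z * K R S))"
      unfolding K_def x_def[symmetric] u_def[symmetric]
      using two_type_binomial_identity[OF finS, of x c u d A] unfolding y_def z_def by simp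
    finally have "F R S * ((x + y) * (u + z)) =
        prod \<rho> (S \<inter> A) * (x + y) ^ card (S \<inter> A) * (u + z) ^ card (S - A) * K R S"
      using yz by (simp add: ac_simps)
    then show ?thesis unfolding xu F_def K_def .
  qed
qed

subsection \<open>Trees and parent maps\<close>

lemma graph_walk_subgraph:
  assumes "graph_walk U E p" "E \<subseteq> F"
  shows "graph_walk U F p"
  using assms unfolding graph_walk_def by (auto elim: successively_mono)

lemma joined_refl: "x \<in> U \<Longrightarrow> joined U E x x"
  unfolding joined_def graph_walk_def by (intro exI[of _ "[x]"]) simp

lemma joined_edge:
  assumes "{x, y} \<in> E" "x \<in> U" "y \<in> U"
  shows "joined U E x y"
  unfolding joined_def graph_walk_def using assms by (intro exI[of _ "[x, y]"]) simp

lemma joined_sym: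
  assumes "joined U E x y"
  shows "joined U E y x"
proof -
  obtain p where "graph_walk U E p" "hd p = x" "last p = y"
    using assms unfolding joined_def by blast
  then show ?thesis
    unfolding joined_def graph_walk_def
    by (intro exI[of _ "rev p"]) (simp add: hd_rev last_rev insert_commute)
qed

lemma joined_trans:
  assumes "joined U E x y" "joined U E y z"
  shows "joined U E x z"
proof -
  obtain p where p: "graph_walk U E p" "hd p = x" "last p = y"
    using assms(1) unfolding joined_def by blast
  obtain q where q: "graph_walk U E q" "hd q = y" "last q = z"
    using assms(2) unfolding joined_def by blast
  obtain q' where q': "q = y # q'"
    using q unfolding graph_walk_def by (cases q) auto
  have "graph_walk U E (p @ q')"
    using p q unfolding q' graph_walk_def
    by (auto simp: successively_append_iff successively_Cons)
  moreover have "hd (p @ q') = x" "last (p @ q') = z"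
    using p q unfolding q' graph_walk_def by (auto split: if_splits)
  ultimately show ?thesis unfolding joined_def by blast
qed

text \<open>A walk of least length is a path, since a repeated vertex would allow the closed piece
  between two occurrences to be cut out.\<close>

lemma joined_imp_path:
  assumes "joined U E x y"
  obtains p where "graph_path U E p" "hd p = x" "last p = y"
proof -
  let ?P = "\<lambda>p. graph_walk U E p \<and> hd p = x \<and> last p = y"
  obtain p where p: "?P p" and min: "\<And>q. ?P q \<Longrightarrow> length p \<le> length q"
    using assms ex_has_least_nat[of ?P _ length] unfolding joined_def by blast
  have "distinct p"
  proof (rule ccontr)
    assume "\<not> distinct p"
    then obtain xs ys zs w where d: "p = xs @ [w] @ ys @ [w] @ zs"
      using not_distinct_decomp by blast
    let ?e = "\<lambda>x y. {x, y} \<in> E"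
    have "successively ?e xs" "xs = [] \<or> {last xs, w} \<in> E" "successively ?e (w # zs)"
      using p unfolding d graph_walk_def
      by (auto simp: successively_append_iff successively_Cons)
    then have "successively ?e (xs @ [w] @ zs)"
      by (auto simp: successively_append_iff)
    moreover have "hd (xs @ [w] @ zs) = hd p" "last (xs @ [w] @ zs) = last p"
      unfolding d by (cases xs) simp_all
    ultimately have "?P (xs @ [w] @ zs)"
      using p unfolding d graph_walk_def by auto
    from min[OF this] show False unfolding d by simp
  qed
  then show ?thesis using that p unfolding graph_path_def by blast
qed

text \<open>
  Every edge joins a point of \<open>Y\<close> to its image under \<open>g\<close>, which has smaller rank; this one property
  rules out cycles and determines the paths to the root, both in the forest and in the reduced graph.
\<close>

definition oriented_by :: "'b set set \<Rightarrow> 'b set \<Rightarrow> ('b \<Rightarrow> 'b) \<Rightarrow> ('b \<Rightarrow> nat) \<Rightarrow> bool" where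
  "oriented_by E Y g d \<longleftrightarrow> (\<forall>x y. {x, y} \<in> E \<longrightarrow>
     x \<in> Y \<and> y = g x \<and> d y < d x \<or> y \<in> Y \<and> x = g y \<and> d x < d y)"

lemma oriented_by_parent_edges:
  assumes "\<And>y. y \<in> Y \<Longrightarrow> d (g y) < (d y :: nat)"
  shows "oriented_by ((\<lambda>y. {y, g y}) ` Y) Y g d"
  unfolding oriented_by_def using assms by (auto simp: doubleton_eq_iff)

text \<open>At a vertex of largest rank on a cycle, both neighbours have to be its image under
  \<open>g\<close>; but on a cycle with at least three vertices they are different.\<close>

lemma oriented_by_no_cycle:
  assumes "oriented_by E Y g d"
  shows "\<not> graph_cycle U E p"
proof
  assume cyc: "graph_cycle U E p"
  let ?n = "length p"
  have n: "?n \<ge> 3" and dist: "distinct p" and succ: "successively (\<lambda>x y. {x, y} \<in> E) p"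
    and close: "{last p, hd p} \<in> E"
    using cyc unfolding graph_cycle_def graph_path_def graph_walk_def by auto
  have edge: "{p ! i, p ! (Suc i mod ?n)} \<in> E" if "i < ?n" for i
  proof (cases "Suc i < ?n")
    case True
    then show ?thesis using succ by (simp add: successively_conv_nth)
  next
    case False
    then have "i = ?n - 1" "Suc i = ?n" using that by auto
    moreover have "p \<noteq> []" using n by auto
    ultimately show ?thesis using close by (simp add: last_conv_nth hd_conv_nth)
  qed
  have "finite (d ` set p)" "d ` set p \<noteq> {}" using n by auto
  then have "Max (d ` set p) \<in> d ` set p" by (rule Max_in)
  then obtain x where x: "x \<in> set p" "d x = Max (d ` set p)" by (metis imageE)
  have max: "d y \<le> d x" if "y \<in> set p" for y unfolding x(2) using that by simp
  obtain i where i: "i < ?n" "p ! i = x" using x(1) by (auto simp: in_set_conv_nth)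
  \<comment> \<open>The two neighbours of position \<open>i\<close>, with wrap-around at the ends of
    the list.\<close>
  let ?j = "Suc i mod ?n" and ?k = "(if i = 0 then ?n - 1 else i - 1)"
  have "0 < ?n" using n by linarith
  then have j: "?j < ?n" by (rule mod_less_divisor)
  have k: "?k < ?n" "Suc ?k mod ?n = i"
    using i(1) \<open>0 < ?n\<close> by (cases "i = 0"; simp)+
  have "p ! ?j = g x"
    using assms edge[OF i(1)] max[OF nth_mem[OF j]] unfolding i(2) oriented_by_def by fastforce
  moreover have "p ! ?k = g x"
    using assms edge[OF k(1)] max[OF nth_mem[OF k(1)]] unfolding k(2) i(2) oriented_by_def by fastforce
  moreover have "?j \<noteq> ?k"
  proof (cases "Suc i < ?n")
    case True
    then show ?thesis using n by auto
  next
    case False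
    then have "Suc i = ?n" using i by auto
    then show ?thesis using n by auto
  qed
  ultimately show False using nth_eq_iff_index_eq[OF dist j k(1)] by simp
qed

text \<open>A path that does not start towards the root moves away from it forever.\<close>

lemma oriented_by_path_first_step:
  assumes "oriented_by E Y g d" "graph_path U E p" "last p \<notin> Y" "hd p \<noteq> last p"
  shows "p ! 1 = g (hd p)"
proof -
  \<comment> \<open>If \<open>y\<close> is not \<open>g x\<close>, the edge forces
    \<open>x = g y\<close> and \<open>y\<close> in \<open>Y\<close>. As a path does not return to
    \<open>x\<close>, its next vertex is not \<open>g y\<close>, so the situation repeats up to the
    last vertex.\<close>
  have away: "last (y # q) \<in> Y"
    if "successively (\<lambda>x y. {x, y} \<in> E) (x # y # q)" "distinct (x # y # q)" "y \<noteq> g x" for x y q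
    using that
  proof (induction q arbitrary: x y)
    case Nil
    then show ?case using assms(1) unfolding oriented_by_def by auto
  next
    case (Cons z q)
    then have "x = g y" using assms(1) unfolding oriented_by_def by auto
    then show ?case using Cons.IH[of y z] Cons.prems by auto
  qed
  obtain x y q where p: "p = x # y # q"
    using assms(2,4) unfolding graph_path_def graph_walk_def
    by (metis last_ConsL list.exhaust list.sel(1))
  show ?thesis
    using away[of x y q] assms(2,3) unfolding p graph_path_def graph_walk_def by auto
qed

lemma parent_edges_joined_root:
  assumes "r \<in> U" "\<And>x. x \<in> U - {r} \<Longrightarrow> g x \<in> U \<and> d (g x) < (d x :: nat)" "x \<in> U"
  shows "joined U ((\<lambda>x. {x, g x}) ` (U - {r})) x r"
  using assms(3)
proof (induction "d x" arbitrary: x rule: less_induct)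
  case less
  let ?F = "(\<lambda>x. {x, g x}) ` (U - {r})"
  show ?case
  proof (cases "x = r")
    case True
    then show ?thesis using less by (simp add: joined_refl)
  next
    case False
    then have x: "x \<in> U - {r}" using less by blast
    then have "joined U ?F x (g x)" using assms(2) by (intro joined_edge) blast+
    moreover have "joined U ?F (g x) r" using assms(2)[OF x] less.hyps by blast
    ultimately show ?thesis by (rule joined_trans)
  qed
qed

text \<open>Moving to the next vertex of a shortest walk to \<open>r\<close> gives \<open>g\<close>.
  These edges already connect all of \<open>U\<close>, so acyclicity leaves room for no other
  edge.\<close>

lemma tree_graph_parent_edges:
  assumes "tree_graph U F" "r \<in> U"
  shows "\<exists>g d. (\<forall>x\<in>U - {r}. g x \<in> U \<and> d (g x) < (d x :: nat)) \<and> F = (\<lambda>x. {x, g x}) ` (U - {r})"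
proof -
  let ?W = "\<lambda>x p. graph_walk U F p \<and> hd p = x \<and> last p = r"
  \<comment> \<open>The rank counts the vertices of a shortest walk to \<open>r\<close>; the tail of
    such a walk bounds the rank of its second vertex.\<close>
  define d where "d x = (LEAST n. \<exists>p. ?W x p \<and> length p = n)" for x
  have "\<exists>y\<in>U. {x, y} \<in> F \<and> d y < d x" if x: "x \<in> U - {r}" for x
  proof -
    have "joined U F x r" using x assms unfolding tree_graph_def connected_graph_def by blast
    then have "\<exists>n p. ?W x p \<and> length p = n" unfolding joined_def by blast
    then have "\<exists>p. ?W x p \<and> length p = d x" unfolding d_def by (rule LeastI_ex)
    then obtain p where p: "?W x p" "length p = d x" by blast
    obtain y q where q: "p = x # y # q"
      using p(1) x unfolding graph_walk_def by (metis Diff_iff insertI1 last_ConsL list.exhaust list.sel(1))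
    have "?W y (y # q)" using p(1) unfolding q graph_walk_def by auto
    then have "d y \<le> length (y # q)" unfolding d_def by (intro Least_le) blast
    then have "d y < d x" using p(2) unfolding q by simp
    moreover have "y \<in> U" "{x, y} \<in> F" using p(1) unfolding q graph_walk_def by auto
    ultimately show ?thesis by blast
  qed
  then obtain g where g: "\<And>x. x \<in> U - {r} \<Longrightarrow> g x \<in> U \<and> {x, g x} \<in> F \<and> d (g x) < d x" by metis
  let ?F = "(\<lambda>x. {x, g x}) ` (U - {r})"
  have to_root: "joined U ?F x r" if "x \<in> U" for x
    using assms(2) g that by (intro parent_edges_joined_root[where d = d]) blast+
  \<comment> \<open>An edge outside the spanning tree \<open>?F\<close> closes a path of \<open>?F\<close> to a cycle.\<close>
  have "F \<subseteq> ?F"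
  proof
    fix e assume e: "e \<in> F"
    then have "e \<subseteq> U" "card e = 2" using assms unfolding tree_graph_def simple_graph_def by blast+
    then obtain x y where xy: "e = {x, y}" "x \<noteq> y" "x \<in> U" "y \<in> U" by (auto simp: card_2_iff)
    have "joined U ?F x y"
      by (rule joined_trans[OF to_root[OF xy(3)] joined_sym[OF to_root[OF xy(4)]]])
    then obtain p where p: "graph_path U ?F p" "hd p = x" "last p = y" by (rule joined_imp_path)
    show "e \<in> ?F"
    proof (rule ccontr)
      assume "e \<notin> ?F"
      have "length p \<ge> 3"
      proof (rule ccontr)
        assume "\<not> length p \<ge> 3"
        then have "p = [] \<or> (\<exists>z. p = [z]) \<or> (\<exists>z w. p = [z, w])"
          by (auto simp: not_le numeral_3_eq_3 less_Suc_eq length_Suc_conv)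
        then have "p = [x, y]"
          using p xy(2) by (auto simp: graph_path_def graph_walk_def)
        then show False
          using p(1) \<open>e \<notin> ?F\<close> unfolding xy(1) graph_path_def graph_walk_def by simp
      qed
      moreover have "graph_path U F p"
        using p(1) g graph_walk_subgraph[of U ?F p F] unfolding graph_path_def by blast
      ultimately have "graph_cycle U F p"
        using p(2,3) e xy(1) unfolding graph_cycle_def by (simp add: insert_commute)
      then show False using assms(1) unfolding tree_graph_def by blast
    qed
  qed
  then have "F = ?F" using g by blast
  then show ?thesis using g by blast
qed

text \<open>Converse direction: following parents leads to the root, which gives connectedness, and
  the rank excludes cycles.\<close>

lemma parent_edges_tree_graph:
  assumes "finite U" "r \<in> U" "\<And>x. x \<in> U - {r} \<Longrightarrow> g x \<in> U \<and> d (g x) < (d x :: nat)"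
  shows "tree_graph U ((\<lambda>x. {x, g x}) ` (U - {r}))"
proof -
  let ?F = "(\<lambda>x. {x, g x}) ` (U - {r})"
  have "card {x, g x} = 2" if "x \<in> U - {r}" for x
    using assms(3)[OF that] by (metis card_2_iff less_irrefl)
  then have "simple_graph U ?F" using assms unfolding simple_graph_def by auto
  moreover have to_root: "joined U ?F x r" if "x \<in> U" for x
    using assms(2,3) that by (rule parent_edges_joined_root)
  have "connected_graph U ?F"
    unfolding connected_graph_def
    using assms(2) joined_trans[OF to_root joined_sym[OF to_root]] by blast
  moreover have "\<not> graph_cycle U ?F p" for p
    by (rule oriented_by_no_cycle[OF oriented_by_parent_edges[where d = d]]) (use assms(3) in blast)
  ultimately show ?thesis unfolding tree_graph_def by blast
qed

text \<open>Reduces the tree condition on components to the absence of cycles in the whole graph. A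
  component is connected within itself because a walk starting in it never leaves it.\<close>

lemma component_tree_graph:
  assumes "simple_graph U E" "\<And>p. \<not> graph_cycle U E p" "C \<in> graph_components U E"
  shows "tree_graph C {e \<in> E. e \<subseteq> C}"
proof -
  obtain x where x: "x \<in> U" "C = {y \<in> U. joined U E x y}"
    using assms(3) unfolding graph_components_def by blast
  let ?E = "{e \<in> E. e \<subseteq> C}"
  have "simple_graph C ?E"
    using assms(1) x unfolding simple_graph_def by auto
  moreover have "connected_graph C ?E"
    unfolding connected_graph_def
  proof (intro conjI ballI)
    show "C \<noteq> {}" using x joined_refl by fastforce
    fix y z assume y: "y \<in> C" and z: "z \<in> C"
    then have "joined U E y z" using x joined_sym joined_trans by (metis (mono_tags, lifting) mem_Collect_eq)
    then obtain p where p: "graph_walk U E p" "hd p = y" "last p = z" unfolding joined_def by blast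
    have "graph_walk C ?E p" using p(1) p(2) y
    proof (induction p arbitrary: y)
      case Nil
      then show ?case by (simp add: graph_walk_def)
    next
      case (Cons w p)
      show ?case
      proof (cases p)
        case Nil
        then show ?thesis using Cons.prems by (simp add: graph_walk_def)
      next
        case (Cons v q)
        have e: "{w, v} \<in> E" "v \<in> U" "w \<in> C" and walk: "graph_walk U E p"
          using Cons.prems Cons unfolding graph_walk_def by auto
        have "joined U E x v"
          using e x joined_edge[of w v E U] joined_trans[of U E x w v] by blast
        then have "v \<in> C" using e x by blast
        moreover have "graph_walk C ?E p" using Cons.IH[OF walk, of v] Cons \<open>v \<in> C\<close> by simp
        ultimately show ?thesis using e Cons unfolding graph_walk_def by auto
      qed
    qed
    then show "joined C ?E y z" using p unfolding joined_def by blast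
  qed
  moreover have "\<not> graph_cycle C ?E p" for p
  proof
    assume c: "graph_cycle C ?E p"
    then have "graph_walk U E p"
      using x graph_walk_subgraph[of U ?E p E] unfolding graph_cycle_def graph_path_def graph_walk_def by auto
    then have "graph_cycle U E p" using c unfolding graph_cycle_def graph_path_def by blast
    then show False using assms(2) by blast
  qed
  ultimately show ?thesis unfolding tree_graph_def by blast
qed

subsection \<open>Rooted forests\<close>

text \<open>Naming the unordered pair in the other order changes nothing, because the condition on
  the indices is symmetric.\<close>

lemma reduced_edges_iff:
  "{i, j} \<in> reduced_edges M W E \<longleftrightarrow>
    i \<in> {1..M} \<and> j \<in> {1..M} \<and> i \<noteq> j \<and> (\<exists>x\<in>W i. \<exists>y\<in>W j. {x, y} \<in> E)" (is "_ \<longleftrightarrow> ?P i j")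
proof
  assume "{i, j} \<in> reduced_edges M W E"
  then obtain k l where kl: "{i, j} = {k, l}" "?P k l" unfolding reduced_edges_def by blast
  have "?P l k" using kl(2) by (metis insert_commute)
  then show "?P i j" using kl by (auto simp only: doubleton_eq_iff)
next
  assume "?P i j"
  then show "{i, j} \<in> reduced_edges M W E" unfolding reduced_edges_def by blast
qed

locale vertex_family =
  fixes M :: nat and W :: "nat \<Rightarrow> 'a set"
  assumes M_pos: "1 \<le> M"
    and finite_W: "i \<in> {1..M} \<Longrightarrow> finite (W i)"
    and disjoint_W: "disjoint_family_on W {1..M}"
begin

text \<open>Well defined on the union of the sets by disjointness; it transports ranks of indices to
  ranks of vertices.\<close>

definition vertex_index :: "'a \<Rightarrow> nat" where
  "vertex_index x = (THE i. i \<in> {1..M} \<and> x \<in> W i)"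

text \<open>
  A choice \<open>h\<close> for the parent map \<open>f\<close> records in \<open>h j = (r, S)\<close> the root \<open>r\<close> in \<open>W (f j)\<close> and the
  non-empty set \<open>S\<close> of vertices of \<open>W j\<close> that are attached to \<open>r\<close>.
\<close>

definition root_choices :: "(nat \<Rightarrow> nat) \<Rightarrow> (nat \<Rightarrow> 'a \<times> 'a set) set" where
  "root_choices f = (\<Pi>\<^sub>E j\<in>{2..M}. W (f j) \<times> (Pow (W j) - {{}}))"

definition forest_edges :: "(nat \<Rightarrow> 'a \<times> 'a set) \<Rightarrow> 'a set set" where
  "forest_edges h = (\<lambda>(j, y). {fst (h j), y}) ` (SIGMA j:{2..M}. snd (h j))"

lemma index_unique: "i \<in> {1..M} \<Longrightarrow> j \<in> {1..M} \<Longrightarrow> x \<in> W i \<Longrightarrow> x \<in> W j \<Longrightarrow> i = j"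
  using disjoint_W unfolding disjoint_family_on_def by blast

lemma vertex_index_eq: "i \<in> {1..M} \<Longrightarrow> x \<in> W i \<Longrightarrow> vertex_index x = i"
  unfolding vertex_index_def using index_unique by blast

lemma nonroot_indices: "{1..M} - {1} = {2..M}"
  by auto

end

section \<open>The forest belonging to a parent map and its choices\<close>

locale rooted_choice = vertex_family M W for M and W :: "nat \<Rightarrow> 'a set" +
  fixes f :: "nat \<Rightarrow> nat" and d :: "nat \<Rightarrow> nat" and h :: "nat \<Rightarrow> 'a \<times> 'a set"
  assumes parent: "j \<in> {2..M} \<Longrightarrow> f j \<in> {1..M}"
    and parent_less: "j \<in> {2..M} \<Longrightarrow> d (f j) < d j"
    and choices: "h \<in> root_choices f"
begin

lemma choice:
  assumes "j \<in> {2..M}"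
  shows "fst (h j) \<in> W (f j)" "snd (h j) \<subseteq> W j" "snd (h j) \<noteq> {}"
proof -
  have "h j \<in> W (f j) \<times> (Pow (W j) - {{}})"
    using choices assms unfolding root_choices_def by (rule PiE_mem)
  then show "fst (h j) \<in> W (f j)" "snd (h j) \<subseteq> W j" "snd (h j) \<noteq> {}" by auto
qed

lemma forest_edgesE:
  assumes "e \<in> forest_edges h"
  obtains j y where "j \<in> {2..M}" "y \<in> snd (h j)" "e = {fst (h j), y}" "y \<in> W j"
    "f j \<in> {1..M}" "fst (h j) \<in> W (f j)" "d (f j) < d j"
proof -
  obtain j y where "j \<in> {2..M}" "y \<in> snd (h j)" "e = {fst (h j), y}"
    using assms unfolding forest_edges_def by auto
  then show ?thesis using choice[of j] parent[of j] parent_less[of j] by (intro that[of j y]) auto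
qed

text \<open>Disjointness determines the index of each endpoint, so an edge between
  \<open>W i\<close> and \<open>W j\<close> can only stem from the choice at \<open>j\<close> with
  parent \<open>i\<close> or from the choice at \<open>i\<close> with parent
  \<open>j\<close>.\<close>

lemma forest_edges_iff:
  assumes "i \<in> {1..M}" "j \<in> {1..M}" "x \<in> W i" "y \<in> W j"
  shows "{x, y} \<in> forest_edges h \<longleftrightarrow>
    j \<in> {2..M} \<and> i = f j \<and> x = fst (h j) \<and> y \<in> snd (h j) \<or>
    i \<in> {2..M} \<and> j = f i \<and> y = fst (h i) \<and> x \<in> snd (h i)"
proof
  assume "{x, y} \<in> forest_edges h"
  then obtain k z where k: "k \<in> {2..M}" "z \<in> snd (h k)" "{x, y} = {fst (h k), z}" "z \<in> W k"
    "f k \<in> {1..M}" "fst (h k) \<in> W (f k)"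
    by (rule forest_edgesE)
  have kM: "k \<in> {1..M}" using k(1) by auto
  from k(3) consider "x = fst (h k)" "y = z" | "x = z" "y = fst (h k)"
    by (auto simp: doubleton_eq_iff)
  then show "j \<in> {2..M} \<and> i = f j \<and> x = fst (h j) \<and> y \<in> snd (h j) \<or>
    i \<in> {2..M} \<and> j = f i \<and> y = fst (h i) \<and> x \<in> snd (h i)"
  proof cases
    case 1
    have "j = k" using index_unique[OF assms(2) kM assms(4)] k(4) 1 by simp
    moreover have "i = f k" using index_unique[OF assms(1) k(5) assms(3)] k(6) 1 by simp
    ultimately show ?thesis using 1 k by blast
  next
    case 2
    have "i = k" using index_unique[OF assms(1) kM assms(3)] k(4) 2 by simp
    moreover have "j = f k" using index_unique[OF assms(2) k(5) assms(4)] k(6) 2 by simp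
    ultimately show ?thesis using 2 k by blast
  qed
next
  have edge: "{fst (h k), z} \<in> forest_edges h" if "k \<in> {2..M}" "z \<in> snd (h k)" for k z
    unfolding forest_edges_def using that by (intro image_eqI[of _ _ "(k, z)"]) auto
  assume "j \<in> {2..M} \<and> i = f j \<and> x = fst (h j) \<and> y \<in> snd (h j) \<or>
    i \<in> {2..M} \<and> j = f i \<and> y = fst (h i) \<and> x \<in> snd (h i)"
  then consider "j \<in> {2..M}" "x = fst (h j)" "y \<in> snd (h j)" | "i \<in> {2..M}" "y = fst (h i)" "x \<in> snd (h i)"
    by (elim disjE conjE)
  then show "{x, y} \<in> forest_edges h"
  proof cases
    case 1
    then show ?thesis using edge[of j y] by simp
  next
    case 2
    then show ?thesis using edge[of i x] by (simp add: insert_commute)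
  qed
qed

text \<open>Of the two possible origins of such an edge, the choice at \<open>f j\<close> is
  excluded: \<open>j\<close> and \<open>f j\<close> would be parents of each other, against the
  rank.\<close>

lemma parent_edge_iff:
  assumes "j \<in> {2..M}" "x \<in> W (f j)" "y \<in> W j"
  shows "{x, y} \<in> forest_edges h \<longleftrightarrow> x = fst (h j) \<and> y \<in> snd (h j)"
proof -
  have "\<not> (f j \<in> {2..M} \<and> j = f (f j))"
    using parent_less[of "f j"] parent_less[OF assms(1)] by auto
  then show ?thesis
    using forest_edges_iff[OF parent[OF assms(1)] _ assms(2,3)] assms(1) by fastforce
qed

text \<open>A vertex of \<open>snd (h j)\<close> has the root \<open>fst (h j)\<close> as its only
  neighbour of smaller rank. Acyclicity of the forest follows from this, hence also that its
  components are trees.\<close>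

lemma oriented_by_forest_edges:
  "oriented_by (forest_edges h) (\<Union>j\<in>{2..M}. snd (h j)) (\<lambda>y. fst (h (vertex_index y))) (\<lambda>x. d (vertex_index x))"
  unfolding oriented_by_def
proof (intro allI impI)
  fix x y assume "{x, y} \<in> forest_edges h"
  then obtain k z where k: "k \<in> {2..M}" "z \<in> snd (h k)" "{x, y} = {fst (h k), z}" "z \<in> W k"
    "f k \<in> {1..M}" "fst (h k) \<in> W (f k)" "d (f k) < d k"
    by (rule forest_edgesE)
  have "vertex_index z = k" "vertex_index (fst (h k)) = f k"
    using k by (auto intro: vertex_index_eq)
  then show "x \<in> (\<Union>j\<in>{2..M}. snd (h j)) \<and> y = fst (h (vertex_index x)) \<and> d (vertex_index y) < d (vertex_index x) \<or>
    y \<in> (\<Union>j\<in>{2..M}. snd (h j)) \<and> x = fst (h (vertex_index y)) \<and> d (vertex_index x) < d (vertex_index y)"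
    using k by (auto simp: doubleton_eq_iff)
qed

text \<open>Every pair of an index and its parent occurs because the attached sets
  \<open>snd (h j)\<close> are non-empty.\<close>

lemma reduced_forest_edges:
  "reduced_edges M W (forest_edges h) = (\<lambda>j. {j, f j}) ` ({1..M} - {1})"
proof (intro subset_antisym subsetI)
  fix e assume "e \<in> reduced_edges M W (forest_edges h)"
  then obtain i j x y where e: "e = {i, j}" "i \<in> {1..M}" "j \<in> {1..M}" "x \<in> W i" "y \<in> W j"
    "{x, y} \<in> forest_edges h"
    unfolding reduced_edges_def by blast
  then have "j \<in> {2..M} \<and> i = f j \<or> i \<in> {2..M} \<and> j = f i"
    using forest_edges_iff[OF e(2-5)] by auto
  then show "e \<in> (\<lambda>j. {j, f j}) ` ({1..M} - {1})"
    unfolding e(1) nonroot_indices by (auto simp: insert_commute)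
next
  fix e assume "e \<in> (\<lambda>j. {j, f j}) ` ({1..M} - {1})"
  then obtain j where j: "j \<in> {2..M}" "e = {j, f j}" unfolding nonroot_indices by blast
  obtain y where y: "y \<in> snd (h j)" using choice(3)[OF j(1)] by blast
  then have "y \<in> W j" using choice(2)[OF j(1)] by blast
  moreover have "{y, fst (h j)} \<in> forest_edges h"
    using parent_edge_iff[OF j(1) choice(1)[OF j(1)] \<open>y \<in> W j\<close>] y by (simp add: insert_commute)
  moreover have "j \<noteq> f j" using parent_less[OF j(1)] by auto
  moreover have "j \<in> {1..M}" using j(1) by auto
  ultimately show "e \<in> reduced_edges M W (forest_edges h)"
    unfolding reduced_edges_iff j(2) using parent[OF j(1)] choice(1)[OF j(1)] by blast
qed

lemma reduced_tree_graph: "tree_graph {1..M} (reduced_edges M W (forest_edges h))"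
  unfolding reduced_forest_edges
  by (rule parent_edges_tree_graph[where d = d])
    (use M_pos parent parent_less nonroot_indices in auto)

text \<open>Identifies the set \<open>W (p ! 1)\<close> of the root condition with
  \<open>W (f j)\<close>.\<close>

lemma reduced_path_first_step:
  assumes "graph_path {1..M} (reduced_edges M W (forest_edges h)) p" "hd p = j" "last p = 1" "j \<in> {2..M}"
  shows "p ! 1 = f j"
proof -
  have "oriented_by (reduced_edges M W (forest_edges h)) ({1..M} - {1}) f d"
    unfolding reduced_forest_edges nonroot_indices
    by (rule oriented_by_parent_edges) (rule parent_less)
  from oriented_by_path_first_step[OF this assms(1)] assms show ?thesis by auto
qed

lemma rooted_forest_forest_edges: "rooted_forest M W (forest_edges h)"
  unfolding rooted_forest_def
proof (intro conjI ballI allI impI)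
  let ?U = "\<Union>i\<in>{1..M}. W i"
  show simple: "simple_graph ?U (forest_edges h)"
    unfolding simple_graph_def
  proof (intro conjI ballI)
    show "finite ?U" using finite_W by blast
    fix e assume "e \<in> forest_edges h"
    then obtain k z where k: "k \<in> {2..M}" "e = {fst (h k), z}" "z \<in> W k"
      "f k \<in> {1..M}" "fst (h k) \<in> W (f k)" "d (f k) < d k"
      by (rule forest_edgesE)
    have kM: "k \<in> {1..M}" using k(1) by auto
    then show "e \<subseteq> ?U" using k by blast
    have "k \<noteq> f k" using k(6) by auto
    then have "fst (h k) \<noteq> z" using index_unique[OF kM k(4) k(3)] k(5) by auto
    then show "card e = 2" unfolding k(2) by simp
  qed
  fix C assume "C \<in> graph_components ?U (forest_edges h)"
  then show "tree_graph C {e \<in> forest_edges h. e \<subseteq> C}"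
    by (rule component_tree_graph[OF simple oriented_by_no_cycle[OF oriented_by_forest_edges]])
next
  fix j x y assume "j \<in> {1..M}" "x \<in> W j" "y \<in> W j"
  then show "{x, y} \<notin> forest_edges h"
    using forest_edges_iff[of j j x y] parent_less[of j] by auto
next
  show "tree_graph {1..M} (reduced_edges M W (forest_edges h))" by (rule reduced_tree_graph)
next
  fix j p assume j: "j \<in> {2..M}"
    and "graph_path {1..M} (reduced_edges M W (forest_edges h)) p \<and> hd p = j \<and> last p = 1"
  then have "p ! 1 = f j" using reduced_path_first_step by blast
  then show "\<exists>r\<in>W (p ! 1). \<forall>x\<in>W (p ! 1). \<forall>y\<in>W j. {x, y} \<in> forest_edges h \<longrightarrow> x = r"
    using choice(1)[OF j] parent_edge_iff[OF j] by auto
qed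

text \<open>Each edge arises from only one pair of a child index \<open>j\<close> and an attached
  vertex \<open>y\<close>, so the product over edges splits according to \<open>j\<close>.\<close>

lemma prod_forest_edges:
  fixes \<omega> :: "'a set \<Rightarrow> real"
  shows "(\<Prod>e\<in>forest_edges h. \<omega> e) = (\<Prod>j\<in>{2..M}. \<Prod>y\<in>snd (h j). \<omega> {fst (h j), y})"
proof -
  have "inj_on (\<lambda>(j, y). {fst (h j), y}) (SIGMA j:{2..M}. snd (h j))"
  proof (rule inj_onI, clarify)
    fix j y k z
    assume j: "j \<in> {2..M}" "y \<in> snd (h j)" and k: "k \<in> {2..M}" "z \<in> snd (h k)"
      and eq: "{fst (h j), y} = {fst (h k), z}"
    have M: "j \<in> {1..M}" "k \<in> {1..M}" using j k by auto
    have W: "y \<in> W j" "z \<in> W k" using j k choice(2) by blast+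
    from eq consider "y = z" | "fst (h j) = z" "y = fst (h k)" by (auto simp: doubleton_eq_iff)
    then show "j = k \<and> y = z"
    proof cases
      case 1
      then show ?thesis using index_unique[OF M] W by blast
    next
      \<comment> \<open>Both ends of the edge would be attached vertices, making \<open>j\<close>
        and \<open>k\<close> parents of each other.\<close>
      case 2
      have "f j = k" using index_unique[OF parent[OF j(1)] M(2)] choice(1)[OF j(1)] W 2 by blast
      moreover have "f k = j" using index_unique[OF parent[OF k(1)] M(1)] choice(1)[OF k(1)] W 2 by blast
      ultimately show ?thesis using parent_less[OF j(1)] parent_less[OF k(1)] by simp
    qed
  qed
  then have "(\<Prod>e\<in>forest_edges h. \<omega> e) = (\<Prod>(j, y)\<in>(SIGMA j:{2..M}. snd (h j)). \<omega> {fst (h j), y})"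
    unfolding forest_edges_def by (simp add: prod.reindex case_prod_unfold)
  also have "\<dots> = (\<Prod>j\<in>{2..M}. \<Prod>y\<in>snd (h j). \<omega> {fst (h j), y})"
  proof (rule prod.Sigma[symmetric])
    show "\<forall>j\<in>{2..M}. finite (snd (h j))"
    proof
      fix j assume j: "j \<in> {2..M}"
      then have "finite (W j)" by (intro finite_W) auto
      with choice(2)[OF j] show "finite (snd (h j))" by (rule finite_subset)
    qed
  qed simp
  finally show ?thesis .
qed

end

section \<open>Rooted forests correspond to parent maps with choices\<close>

context vertex_family
begin

lemma rooted_choiceI:
  assumes "f \<in> parent_maps {1} {2..M}" "h \<in> root_choices f"
  obtains d where "rooted_choice M W f d h"
proof -
  obtain d :: "nat \<Rightarrow> nat" where d: "f \<in> {2..M} \<rightarrow>\<^sub>E {1} \<union> {2..M}" "\<And>j. j \<in> {2..M} \<Longrightarrow> d (f j) < d j"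
    using assms(1) unfolding parent_maps_def by blast
  have "f j \<in> {1..M}" if "j \<in> {2..M}" for j using PiE_mem[OF d(1) that] M_pos by auto
  then have "rooted_choice M W f d h"
    by unfold_locales (use d assms(2) in auto)
  then show ?thesis by (rule that)
qed

text \<open>The reduced graph gives back \<open>f j\<close> as the second vertex of the path from
  \<open>j\<close> to \<open>1\<close>. The edges between \<open>W (f j)\<close> and
  \<open>W j\<close> then give back the attached set and, as this set is non-empty, also the
  root.\<close>

lemma forest_edges_inj:
  assumes "f \<in> parent_maps {1} {2..M}" "h \<in> root_choices f"
    and "f' \<in> parent_maps {1} {2..M}" "h' \<in> root_choices f'"
    and eq: "forest_edges h = forest_edges h'"
  shows "f = f' \<and> h = h'"
proof -
  obtain d where "rooted_choice M W f d h" using rooted_choiceI[OF assms(1,2)] .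
  then interpret A: rooted_choice M W f d h .
  obtain d' where "rooted_choice M W f' d' h'" using rooted_choiceI[OF assms(3,4)] .
  then interpret B: rooted_choice M W f' d' h' .
  have f: "f j = f' j" if j: "j \<in> {2..M}" for j
  proof -
    have "joined {1..M} (reduced_edges M W (forest_edges h)) j 1"
      using A.reduced_tree_graph j M_pos unfolding tree_graph_def connected_graph_def by auto
    then obtain p where p: "graph_path {1..M} (reduced_edges M W (forest_edges h)) p" "hd p = j" "last p = 1"
      by (rule joined_imp_path)
    show ?thesis
      using A.reduced_path_first_step[OF p j] B.reduced_path_first_step[OF p[unfolded eq] j] by simp
  qed
  have "f \<in> {2..M} \<rightarrow>\<^sub>E {1} \<union> {2..M}" "f' \<in> {2..M} \<rightarrow>\<^sub>E {1} \<union> {2..M}"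
    using assms(1,3) unfolding parent_maps_def by blast+
  then have "f = f'" using f by (rule PiE_ext)
  have h: "h j = h' j" if j: "j \<in> {2..M}" for j
  proof -
    have iff: "x = fst (h j) \<and> y \<in> snd (h j) \<longleftrightarrow> x = fst (h' j) \<and> y \<in> snd (h' j)"
      if "x \<in> W (f j)" "y \<in> W j" for x y
      using A.parent_edge_iff[OF j that] B.parent_edge_iff[OF j] that f[OF j] eq by auto
    obtain y where "y \<in> snd (h j)" using A.choice(3)[OF j] by blast
    then have fst: "fst (h j) = fst (h' j)" using iff[of "fst (h j)" y] A.choice[OF j] by blast
    have "snd (h j) = snd (h' j)"
      using iff[OF A.choice(1)[OF j]] fst A.choice(2)[OF j] B.choice(2)[OF j] by blast
    then show ?thesis using fst by (simp add: prod_eq_iff)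
  qed
  have "h = h'"
    by (rule PiE_ext[of _ "{2..M}" "\<lambda>j. W (f j) \<times> (Pow (W j) - {{}})"])
      (use assms(2,4) h \<open>f = f'\<close> in \<open>simp_all add: root_choices_def\<close>)
  then show ?thesis using \<open>f = f'\<close> by blast
qed

text \<open>Directing the reduced tree towards \<open>1\<close> supplies the parents, and the root
  condition supplies the roots; the attached set consists of all neighbours of the root in
  \<open>W j\<close>.\<close>

lemma forest_edges_surj:
  assumes "rooted_forest M W E"
  obtains f h where "f \<in> parent_maps {1} {2..M}" "h \<in> root_choices f" "E = forest_edges h"
proof -
  let ?R = "reduced_edges M W E"
  have simple: "simple_graph (\<Union>i\<in>{1..M}. W i) E"
    and inner: "\<And>j x y. j \<in> {1..M} \<Longrightarrow> x \<in> W j \<Longrightarrow> y \<in> W j \<Longrightarrow> {x, y} \<notin> E"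
    and tree: "tree_graph {1..M} ?R"
    and root: "\<And>j p. j \<in> {2..M} \<Longrightarrow> graph_path {1..M} ?R p \<Longrightarrow> hd p = j \<Longrightarrow> last p = 1 \<Longrightarrow>
        \<exists>r\<in>W (p ! 1). \<forall>x\<in>W (p ! 1). \<forall>y\<in>W j. {x, y} \<in> E \<longrightarrow> x = r"
    using assms unfolding rooted_forest_def by blast+
  have "1 \<in> {1..M}" using M_pos by simp
  from tree_graph_parent_edges[OF tree this] obtain g :: "nat \<Rightarrow> nat" and d :: "nat \<Rightarrow> nat"
    where gd: "\<forall>j\<in>{2..M}. g j \<in> {1..M} \<and> d (g j) < d j"
      and R: "?R = (\<lambda>j. {j, g j}) ` {2..M}"
    unfolding nonroot_indices by blast
  have g: "g j \<in> {1..M} \<and> d (g j) < d j" if "j \<in> {2..M}" for j using gd that by (rule bspec)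
  have "\<exists>r. r \<in> W (g j) \<and> (\<forall>x\<in>W (g j). \<forall>y\<in>W j. {x, y} \<in> E \<longrightarrow> x = r)" if j: "j \<in> {2..M}" for j
  proof -
    have "joined {1..M} ?R j 1"
      using tree j M_pos unfolding tree_graph_def connected_graph_def by auto
    then obtain p where p: "graph_path {1..M} ?R p" "hd p = j" "last p = 1"
      by (rule joined_imp_path)
    \<comment> \<open>The path in the root condition leaves \<open>j\<close> through its parent, so
      the condition speaks about \<open>W (g j)\<close>.\<close>
    have "oriented_by ?R {2..M} g d"
      unfolding R by (rule oriented_by_parent_edges) (use g in blast)
    from oriented_by_path_first_step[OF this p(1)] have "p ! 1 = g j" using p j by auto
    then show ?thesis using root[OF j p] by auto
  qed
  then obtain r where r: "\<And>j. j \<in> {2..M} \<Longrightarrow> r j \<in> W (g j)"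
    and unique: "\<And>j x y. j \<in> {2..M} \<Longrightarrow> x \<in> W (g j) \<Longrightarrow> y \<in> W j \<Longrightarrow> {x, y} \<in> E \<Longrightarrow> x = r j"
    by metis
  \<comment> \<open>Both functions are restricted to \<open>{2..M}\<close>, since
    \<open>parent_maps\<close> and \<open>root_choices\<close> consist of extensional
    functions.\<close>
  define f where "f = restrict g {2..M}"
  define h where "h = (\<lambda>j\<in>{2..M}. (r j, {y \<in> W j. {r j, y} \<in> E}))"
  have "f \<in> {2..M} \<rightarrow>\<^sub>E {1} \<union> {2..M}"
    unfolding f_def restrict_PiE_iff using g by fastforce
  then have f: "f \<in> parent_maps {1} {2..M}"
    by (rule parent_mapsI[where d = d]) (use g f_def in auto)
  have edge: "{y \<in> W j. {r j, y} \<in> E} \<noteq> {}" if j: "j \<in> {2..M}" for j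
  proof -
    have "{g j, j} \<in> ?R" unfolding R using j by (auto simp: insert_commute)
    then obtain x y where xy: "x \<in> W (g j)" "y \<in> W j" "{x, y} \<in> E"
      unfolding reduced_edges_iff by blast
    then show ?thesis using unique[OF j xy] by blast
  qed
  have h: "h \<in> root_choices f"
    unfolding root_choices_def h_def restrict_PiE_iff using edge r by (auto simp: f_def)
  obtain d' where "rooted_choice M W f d' h" using rooted_choiceI[OF f h] .
  then interpret rooted_choice M W f d' h .
  have hj: "fst (h j) = r j" "snd (h j) = {y \<in> W j. {r j, y} \<in> E}" "f j = g j" if "j \<in> {2..M}" for j
    using that by (simp_all add: h_def f_def)
  have "E \<subseteq> forest_edges h"
  proof
    fix e assume e: "e \<in> E"
    then have "e \<subseteq> (\<Union>i\<in>{1..M}. W i)" "card e = 2" using simple unfolding simple_graph_def by blast+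
    then obtain x y i k where xy: "e = {x, y}" "x \<in> W i" "y \<in> W k" and ik: "i \<in> {1..M}" "k \<in> {1..M}"
      by (auto simp: card_2_iff)
    \<comment> \<open>No edge lies inside one of the sets, so it shows up in the reduced tree as a
      pair of an index and its parent, in either order.\<close>
    have "i \<noteq> k" using inner ik xy e by blast
    then have "{i, k} \<in> ?R" unfolding reduced_edges_iff using ik xy e by auto
    then obtain j where j: "j \<in> {2..M}" "{i, k} = {j, g j}" unfolding R by blast
    from j(2) consider "i = j" "k = g j" | "i = g j" "k = j" unfolding doubleton_eq_iff by blast
    then obtain x' y' where xy': "e = {x', y'}" "x' \<in> W (g j)" "y' \<in> W j"
    proof cases
      case 1
      show ?thesis by (rule that[of y x]) (use xy 1 in auto)
    next
      case 2
      show ?thesis by (rule that[of x y]) (use xy 2 in auto)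
    qed
    have "x' = r j" using unique[OF j(1) xy'(2,3)] e unfolding xy'(1) .
    then show "e \<in> forest_edges h"
      using parent_edge_iff[OF j(1), of x' y'] xy' e hj[OF j(1)] by auto
  qed
  moreover have "forest_edges h \<subseteq> E"
    unfolding forest_edges_def using hj by auto
  ultimately have "E = forest_edges h" by (rule subset_antisym)
  with f h show ?thesis by (rule that)
qed

lemma bij_betw_forest_edges:
  "bij_betw (\<lambda>(f, h). forest_edges h) (SIGMA f:parent_maps {1} {2..M}. root_choices f) {E. rooted_forest M W E}"
  unfolding bij_betw_def
proof
  show "inj_on (\<lambda>(f, h). forest_edges h) (SIGMA f:parent_maps {1} {2..M}. root_choices f)"
  proof (rule inj_onI, clarify)
    fix f h f' h'
    assume "f \<in> parent_maps {1} {2..M}" "h \<in> root_choices f"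
      "f' \<in> parent_maps {1} {2..M}" "h' \<in> root_choices f'" "forest_edges h = forest_edges h'"
    then show "f = f' \<and> h = h'" by (rule forest_edges_inj)
  qed
  show "(\<lambda>(f, h). forest_edges h) ` (SIGMA f:parent_maps {1} {2..M}. root_choices f) = {E. rooted_forest M W E}"
  proof (intro subset_antisym subsetI)
    fix E assume "E \<in> (\<lambda>(f, h). forest_edges h) ` (SIGMA f:parent_maps {1} {2..M}. root_choices f)"
    then obtain f h where fh: "f \<in> parent_maps {1} {2..M}" "h \<in> root_choices f" "E = forest_edges h" by blast
    obtain d where "rooted_choice M W f d h" using rooted_choiceI[OF fh(1,2)] .
    then show "E \<in> {E. rooted_forest M W E}"
      unfolding fh(3) by (simp add: rooted_choice.rooted_forest_forest_edges)
  next
    fix E assume "E \<in> {E. rooted_forest M W E}"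
    then have "rooted_forest M W E" by simp
    then obtain f h where "f \<in> parent_maps {1} {2..M}" "h \<in> root_choices f" "E = forest_edges h"
      by (rule forest_edges_surj)
    then show "E \<in> (\<lambda>(f, h). forest_edges h) ` (SIGMA f:parent_maps {1} {2..M}. root_choices f)"
      by (intro image_eqI[of _ _ "(f, h)"]) simp_all
  qed
qed

text \<open>For a fixed parent map the choices at different \<open>j\<close> are independent, so the
  sum over \<open>root_choices f\<close> of a product becomes a product of sums.\<close>

lemma sum_rooted_forests:
  fixes \<omega> :: "'a set \<Rightarrow> real"
  shows "(\<Sum>E | rooted_forest M W E. \<Prod>e\<in>E. \<omega> e) =
    (\<Sum>f\<in>parent_maps {1} {2..M}. \<Prod>j\<in>{2..M}. \<Sum>r\<in>W (f j). \<Sum>S\<in>Pow (W j) - {{}}. \<Prod>y\<in>S. \<omega> {r, y})"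
proof -
  have fin: "finite (W j)" if "j \<in> {2..M}" for j using that finite_W[of j] by auto
  have finf: "finite (W (f j))" if "f \<in> parent_maps {1} {2..M}" "j \<in> {2..M}" for f j
  proof -
    have "f j \<in> {1} \<union> {2..M}" using that unfolding parent_maps_def by blast
    then show ?thesis using finite_W[of "f j"] M_pos by auto
  qed
  have "(\<Sum>E | rooted_forest M W E. \<Prod>e\<in>E. \<omega> e) =
    (\<Sum>(f, h)\<in>(SIGMA f:parent_maps {1} {2..M}. root_choices f). \<Prod>e\<in>forest_edges h. \<omega> e)"
    using sum.reindex_bij_betw[OF bij_betw_forest_edges, of "\<lambda>E. \<Prod>e\<in>E. \<omega> e"]
    by (simp add: case_prod_unfold)
  also have "\<dots> = (\<Sum>f\<in>parent_maps {1} {2..M}. \<Sum>h\<in>root_choices f. \<Prod>e\<in>forest_edges h. \<omega> e)"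
  proof (rule sum.Sigma[symmetric])
    show "finite (parent_maps {1} {2..M})" by (rule finite_parent_maps) simp_all
    show "\<forall>f\<in>parent_maps {1} {2..M}. finite (root_choices f)"
      unfolding root_choices_def using fin finf by (intro ballI finite_PiE) auto
  qed
  also have "\<dots> = (\<Sum>f\<in>parent_maps {1} {2..M}. \<Prod>j\<in>{2..M}. \<Sum>r\<in>W (f j). \<Sum>S\<in>Pow (W j) - {{}}. \<Prod>y\<in>S. \<omega> {r, y})"
  proof (rule sum.cong[OF refl])
    fix f assume f: "f \<in> parent_maps {1} {2..M}"
    have "(\<Sum>h\<in>root_choices f. \<Prod>e\<in>forest_edges h. \<omega> e) =
      (\<Sum>h\<in>root_choices f. \<Prod>j\<in>{2..M}. \<Prod>y\<in>snd (h j). \<omega> {fst (h j), y})"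
    proof (rule sum.cong[OF refl])
      fix h assume h: "h \<in> root_choices f"
      obtain d where "rooted_choice M W f d h" using rooted_choiceI[OF f h] .
      then show "(\<Prod>e\<in>forest_edges h. \<omega> e) = (\<Prod>j\<in>{2..M}. \<Prod>y\<in>snd (h j). \<omega> {fst (h j), y})"
        by (rule rooted_choice.prod_forest_edges)
    qed
    also have "\<dots> = (\<Prod>j\<in>{2..M}. \<Sum>(r, S)\<in>W (f j) \<times> (Pow (W j) - {{}}). \<Prod>y\<in>S. \<omega> {r, y})"
      unfolding root_choices_def case_prod_unfold
      by (rule prod_sum_PiE[symmetric]) (use fin finf[OF f] in auto)
    finally show "(\<Sum>h\<in>root_choices f. \<Prod>e\<in>forest_edges h. \<omega> e) =
      (\<Prod>j\<in>{2..M}. \<Sum>r\<in>W (f j). \<Sum>S\<in>Pow (W j) - {{}}. \<Prod>y\<in>S. \<omega> {r, y})"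
      by (simp add: sum.cartesian_product)
  qed
  finally show ?thesis .
qed

end

section \<open>Evaluation of the forest sum\<close>

theorem theorem3:
  fixes m n :: nat and V :: "nat \<Rightarrow> 'a set" and v :: "nat \<Rightarrow> 'a" and a lam :: real
  assumes "m \<ge> 1" and "n \<ge> 1"
    and "\<And>i. i \<in> {1..m} \<Longrightarrow> finite (V i)"
    and "\<And>i. i \<in> {1..m} \<Longrightarrow> V i \<noteq> {}"
    and "disjoint_family_on V {1..m}"
    and "inj_on v {1..n}"
    and "\<And>i k. i \<in> {1..m} \<Longrightarrow> k \<in> {1..n} \<Longrightarrow> v k \<notin> V i"
    and "a > 0" and "lam > 0"
  shows "Q n m V v a lam =
    real (card (V 1)) * lam * (\<Prod>i=2..m. rho V i lam)
      * (real (card (\<Union>i\<in>{1..m}. V i)) + real n) ^ (m - 1)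
      * (lam * real (card (\<Union>i\<in>{1..m}. V i)) + real n * a) ^ (n - 1)"
proof -
  let ?W = "vertex_sets m V v" and ?M = "m + n" and ?N = "real (card (\<Union>i\<in>{1..m}. V i))"
  define \<omega> where "\<omega> e = (if e \<subseteq> v ` {1..n} then a else lam)" for e :: "'a set"
  have WV: "?W i = V i" if "i \<le> m" for i using that by (simp add: vertex_sets_def)
  have Wv: "?W j = {v (j - m)}" "j - m \<in> {1..n}" if "j \<in> {m+1..?M}" for j
    using that by (auto simp: vertex_sets_def)
  have W_cases: "i \<in> {1..m} \<or> i \<in> {m+1..?M}" if "i \<in> {1..?M}" for i using that by auto
  have "disjoint_family_on ?W {1..?M}"
    unfolding disjoint_family_on_def
  proof (intro ballI impI)
    fix i j assume ij: "i \<in> {1..?M}" "j \<in> {1..?M}" "i \<noteq> j"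
    have VV: "V i \<inter> V j = {}" if "i \<in> {1..m}" "j \<in> {1..m}"
      using assms(5) that ij(3) unfolding disjoint_family_on_def by blast
    have vv: "v (i - m) \<noteq> v (j - m)" if "i \<in> {m+1..?M}" "j \<in> {m+1..?M}"
      using inj_onD[OF assms(6), of "i - m" "j - m"] Wv(2)[OF that(1)] Wv(2)[OF that(2)] that ij(3) by auto
    show "?W i \<inter> ?W j = {}"
      using W_cases[OF ij(1)] W_cases[OF ij(2)] VV vv WV Wv assms(7) by (elim disjE) auto
  qed
  then interpret vertex_family ?M ?W
    by unfold_locales (use assms(1,3) in \<open>auto simp: vertex_sets_def\<close>)
  define c where "c i = real (card (?W i))" for i
  \<comment> \<open>The total weight of the possible edges from one additional vertex to the
    vertices of \<open>?W i\<close>.\<close>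
  define d where "d i = (if i \<le> m then lam * c i else a)" for i
  have c_pos: "c i > 0" if "i \<in> {1..?M}" for i
    using W_cases[OF that] assms(3,4) WV Wv(1) unfolding c_def by (auto simp: card_gt_0_iff)
  have d_pos: "d i > 0" if "i \<in> {1..?M}" for i
    using c_pos[OF that] assms(8,9) unfolding d_def by simp
  have not_additional: "x \<notin> v ` {1..n}" if "i \<in> {1..m}" "x \<in> ?W i" for i x
    using that assms(7) WV[of i] by auto
  \<comment> \<open>All edges at \<open>V j\<close> weigh \<open>lam\<close>, so for
    \<open>j\<close> at most \<open>m\<close> the subsets give \<open>rho V j lam\<close> for each
    of the \<open>c i\<close> roots. For larger \<open>j\<close> the singleton is the only non-empty
    subset, and the weight depends on the type of the root.\<close>
  have weight: "(\<Sum>r\<in>?W i. \<Sum>S\<in>Pow (?W j) - {{}}. \<Prod>y\<in>S. \<omega> {r, y}) =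
      (if j \<in> {..m} then rho V j lam * c i else d i)"
    if i: "i \<in> {1..?M}" and j: "j \<in> {2..?M}" for i j
  proof (cases "j \<le> m")
    case True
    have fin: "finite (?W j)" using finite_W[of j] j by auto
    have "(\<Sum>S\<in>Pow (?W j) - {{}}. \<Prod>y\<in>S. \<omega> {r, y}) = rho V j lam" for r
    proof -
      have "(\<Prod>y\<in>S. \<omega> {r, y}) = lam ^ card S * 1 ^ card (?W j - S)" if "S \<in> Pow (?W j)" for S
      proof -
        have "\<omega> {r, y} = lam" if "y \<in> S" for y
          using not_additional[of j y] \<open>S \<in> Pow (?W j)\<close> that True j unfolding \<omega>_def by auto
        then show ?thesis by simp
      qed
      \<comment> \<open>The binomial sum with second weight 1; removing the empty set afterwards
        subtracts 1.\<close>
      then have "(\<Sum>S\<in>Pow (?W j). \<Prod>y\<in>S. \<omega> {r, y}) = (lam + 1) ^ card (?W j)"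
        using sum_Pow_powers[OF fin, of lam 1] by simp
      then show ?thesis
        using fin True unfolding rho_def by (simp add: sum_diff1 WV add.commute)
    qed
    then show ?thesis using True by (simp add: c_def)
  next
    case False
    then have j: "j \<in> {m+1..?M}" using j by auto
    have Pow_eq: "Pow (?W j) - {{}} = {{v (j - m)}}" unfolding Wv(1)[OF j] by auto
    have "(\<Sum>r\<in>?W i. \<omega> {r, v (j - m)}) = d i"
    proof (cases "i \<le> m")
      case True
      have "\<omega> {r, v (j - m)} = lam" if "r \<in> ?W i" for r
        using not_additional[of i r] that True i unfolding \<omega>_def by auto
      then show ?thesis using True by (simp add: d_def c_def)
    next
      case False
      then have i: "i \<in> {m+1..?M}" using i by auto
      show ?thesis using False Wv[OF i] Wv(2)[OF j] by (simp add: d_def \<omega>_def)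
    qed
    then show ?thesis using False by (simp add: Pow_eq)
  qed
  \<comment> \<open>Roots and remaining points together are all indices, regrouped here by
    type.\<close>
  have sums: "sum g ({1} \<union> {2..?M}) = sum g {1..m} + sum g {m+1..?M}" for g :: "nat \<Rightarrow> real"
  proof -
    have "{1} \<union> {2..?M} = {1..m} \<union> {m+1..?M}" using assms(1) by auto
    then show ?thesis by (simp add: sum.union_disjoint)
  qed
  have c_main: "sum c {1..m} = ?N"
    using card_UN_disjoint'[of V "{1..m}"] assms(3,5) by (simp add: c_def WV)
  have c_add: "sum c {m+1..?M} = real n"
    by (simp add: c_def Wv(1))
  have d_main: "sum d {1..m} = lam * ?N"
    unfolding c_main[symmetric] sum_distrib_left by (intro sum.cong) (auto simp: d_def)
  have d_add: "sum d {m+1..?M} = real n * a"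
    by (simp add: d_def)
  have Int: "{2..?M} \<inter> {..m} = {2..m}" and Diff: "{2..?M} - {..m} = {m+1..?M}" using assms(1) by auto
  have split1: "sum g {1..m} = g 1 + sum g {2..m}" for g :: "nat \<Rightarrow> real"
    using assms(1) by (simp add: sum.atLeast_Suc_atMost numeral_2_eq_2)
  define C where "C = ?N + real n"
  define D where "D = lam * ?N + real n * a"
  have CD: "C > 0" "D > 0"
    using assms(2,8,9) unfolding C_def D_def by (simp_all add: add_nonneg_pos)
  have "Q n m V v a lam = (\<Sum>f\<in>parent_maps {1} {2..?M}. \<Prod>j\<in>{2..?M}. \<Sum>r\<in>?W (f j). \<Sum>S\<in>Pow (?W j) - {{}}. \<Prod>y\<in>S. \<omega> {r, y})"
    unfolding Q_def contribution_def \<omega>_def[symmetric] by (rule sum_rooted_forests)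
  also have "\<dots> = (\<Sum>f\<in>parent_maps {1} {2..?M}. \<Prod>j\<in>{2..?M}. if j \<in> {..m} then rho V j lam * c (f j) else d (f j))"
  proof (intro sum.cong prod.cong refl weight)
    fix f j assume f: "f \<in> parent_maps {1} {2..?M}" and j: "j \<in> {2..?M}"
    then have "f j \<in> {1} \<union> {2..?M}" unfolding parent_maps_def by blast
    then show "f j \<in> {1..?M}" using assms(1) by auto
  qed
  finally have Q: "Q n m V v a lam = \<dots>" .
  have idx: "i \<in> {1..?M}" if "i \<in> {1} \<union> {2..?M}" for i using that assms(1) by auto
  \<comment> \<open>With root set \<open>{1}\<close>, the remaining points of the two kinds are
    \<open>{2..m}\<close> and \<open>{m+1..?M}\<close>, which accounts for the exponents
    \<open>m - 1\<close> and \<open>n\<close>.\<close>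
  have "Q n m V v a lam * (C * D) = (\<Prod>i=2..m. rho V i lam) * C ^ (m - 1) * D ^ n *
      (c 1 * d 1 + c 1 * sum d {2..m} + real n * d 1)"
    using sum_parent_maps_two_types[of "{1}" "{2..?M}" c d "{..m}" "\<lambda>j. rho V j lam"]
      c_pos[OF idx] d_pos[OF idx]
    unfolding Q sums Int Diff c_main c_add d_main d_add C_def D_def by simp
  \<comment> \<open>As \<open>sum d {2..m}\<close> is \<open>lam * ?N - d 1\<close>, the products
    \<open>c 1 * d 1\<close> cancel, and \<open>d 1 = lam * c 1\<close> leaves
    \<open>lam * c 1 * (?N + n)\<close>.\<close>
  also have "c 1 * d 1 + c 1 * sum d {2..m} + real n * d 1 = real (card (V 1)) * lam * C"
  proof -
    have d_rest: "sum d {2..m} = lam * ?N - d 1" using d_main split1[of d] by simp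
    have d1: "d 1 = lam * c 1" using assms(1) by (simp add: d_def)
    have c1: "c 1 = real (card (V 1))" using assms(1) by (simp add: c_def WV)
    show ?thesis unfolding d_rest unfolding d1 c1 C_def by (simp add: algebra_simps)
  qed
  \<comment> \<open>Since \<open>n\<close> is positive, one \<open>D\<close> can be split off
    \<open>D ^ n\<close>; together with the new factor \<open>C\<close> it cancels the totals on the
    left.\<close>
  also have "(\<Prod>i=2..m. rho V i lam) * C ^ (m - 1) * D ^ n * (real (card (V 1)) * lam * C) =
     real (card (V 1)) * lam * (\<Prod>i=2..m. rho V i lam) * C ^ (m - 1) * D ^ (n - 1) * (C * D)"
    using assms(2) by (simp add: power_eq_if)
  finally show ?thesis using CD unfolding C_def[symmetric] D_def[symmetric] by simp
qed

end
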